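(* Let $\{\lambda,\underline m\}$ be a pointed knapsack partition of $n$. Then the order complex $\Delta(\Pi^\bullet_{\{\lambda,\underline m\}}-\{\hat 1\})$ is homotopy equivalent to the barycentric subdivision $\operatorname{sd}(\Lambda_{\{\lambda,\underline m\}})$, and hence to the simplicial complex $\Lambda_{\{\lambda,\underline m\}}$.
   Context: An integer partition $\lambda=\{\lambda_1^{e_1},\dots,\lambda_q^{e_q}\}$ (multiset of positive integers, $\lambda_i$ distinct, multiplicities $e_i$) is a knapsack partition if the sums $\sum_i f_i\lambda_i$, $0\le f_i\le e_i$, are pairwise distinct. A pointed knapsack partition $\{\lambda,\underline m\}$ of $n$ is a knapsack partition $\lambda$ together with an integer $m\ge0$ such that the parts of $\lambda$ and $m$ sum to $n$. A pointed set partition of $[n]$ is $\{B_1,\dots,B_j,\underline Z\}$ with $Z\subseteq[n]$ possibly empty (pointed block) and nonempty blocks $B_i$ partitioning $[n]\setminus Z$; its type is the multiset $\{|B_i|\}$ with pointed number $|Z|$. $\Pi^\bullet_n$ is the poset of these with $\pi\le\pi'$ iff each non-pointed block of $\pi$ lies in a block of $\pi'$ and the pointed block of $\pi$ lies in that of $\pi'$. $\Pi^\bullet_{\{\lambda,\underline m\}}$ is the filter of $\Pi^\bullet_n$ generated by all pointed set partitions of type $\{\lambda,\underline m\}$; its maximum is $\hat 1=\{\underline{[n]}\}$; $\Delta(P)$ is the order complex. An ordered set partition of $[n]$ is $(C_1,\dots,C_r)$, pairwise disjoint with union $[n]$, $C_1,\dots,C_{r-1}$ nonempty, $C_r$ possibly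 empty; $\Delta_n$ is the simplicial complex with these faces ($(C_1,\dots,C_r)$ of dimension $r-2$, faces obtained by merging consecutive blocks, $([n])$ the empty face). $\Lambda_{\{\lambda,\underline m\}}$ is the subcomplex of all $(C_1,\dots,C_r)\in\Delta_n$ with $\{C_1,\dots,C_{r-1},\underline{C_r}\}\in\Pi^\bullet_{\{\lambda,\underline m\}}$; $\operatorname{sd}$ is barycentric subdivision. *)

theory Defs
  imports "HOL-Analysis.Analysis" "HOL-Library.Multiset" "HOL-Library.Disjoint_Sets"
begin

section \<open>Abstract simplicial complexes\<close>

text \<open>A complex is given by its set of faces, the empty face included; a face is a finite set
  of vertices.\<close>

definition order_complex :: "'a set \<Rightarrow> ('a \<Rightarrow> 'a \<Rightarrow> bool) \<Rightarrow> 'a set set" where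
  "order_complex P le = {c. c \<subseteq> P \<and> finite c \<and> Complete_Partial_Order.chain le c}"

definition barycentric_subdivision :: "'a set set \<Rightarrow> 'a set set set" where
  "barycentric_subdivision K = order_complex (K - {{}}) (\<subseteq>)"

text \<open>Points are given by their barycentric coordinates. The topology is the one of pointwise
  convergence; for a finite complex (all complexes below are finite) it agrees with the
  coherent topology. The complex \<open>{{}}\<close> is realized by the empty space.\<close>

definition geometric_realization :: "'a set set \<Rightarrow> ('a \<Rightarrow> real) topology" where
  "geometric_realization K =
     top_of_set {x. (\<forall>v. 0 \<le> x v) \<and> (\<exists>s\<in>K. {v. x v \<noteq> 0} \<subseteq> s \<and> sum x s = 1)}"


section \<open>Pointed knapsack partitions\<close>

text \<open>The choices of \<open>f\<^sub>i\<close> with \<open>0 \<le> f\<^sub>i \<le> e\<^sub>i\<close> are the sub-multisets of the partition.\<close>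

definition knapsack_partition :: "nat multiset \<Rightarrow> bool" where
  "knapsack_partition lam \<longleftrightarrow> 0 \<notin># lam \<and> inj_on sum_mset {f. f \<subseteq># lam}"

definition pointed_knapsack_partition :: "nat \<Rightarrow> nat multiset \<Rightarrow> nat \<Rightarrow> bool" where
  "pointed_knapsack_partition n lam m \<longleftrightarrow> knapsack_partition lam \<and> sum_mset lam + m = n"


section \<open>Pointed set partitions\<close>

text \<open>The pair \<open>(Bs, Z)\<close> consists of the set of non-pointed blocks and the pointed block.\<close>

type_synonym pointed_partition = "nat set set \<times> nat set"

definition pointed_partitions :: "nat \<Rightarrow> pointed_partition set" where
  "pointed_partitions n = {(Bs, Z). Z \<subseteq> {1..n} \<and> partition_on ({1..n} - Z) Bs}"

definition pointed_type :: "pointed_partition \<Rightarrow> nat multiset \<times> nat" where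
  "pointed_type = (\<lambda>(Bs, Z). (image_mset card (mset_set Bs), card Z))"

definition pointed_le :: "pointed_partition \<Rightarrow> pointed_partition \<Rightarrow> bool" where
  "pointed_le = (\<lambda>(Bs, Z) (Bs', Z'). (\<forall>B\<in>Bs. \<exists>B'\<in>insert Z' Bs'. B \<subseteq> B') \<and> Z \<subseteq> Z')"

definition pointed_filter :: "nat \<Rightarrow> nat multiset \<Rightarrow> nat \<Rightarrow> pointed_partition set" where
  "pointed_filter n lam m =
     {q \<in> pointed_partitions n.
        \<exists>p \<in> pointed_partitions n. pointed_type p = (lam, m) \<and> pointed_le p q}"

definition pointed_top :: "nat \<Rightarrow> pointed_partition" where
  "pointed_top n = ({}, {1..n})"


section \<open>Ordered set partitions\<close>

definition ordered_partitions :: "nat \<Rightarrow> nat set list set" where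
  "ordered_partitions n =
     {C. C \<noteq> [] \<and> disjoint_family_on (\<lambda>i. C ! i) {..<length C} \<and>
         \<Union>(set C) = {1..n} \<and> {} \<notin> set (butlast C)}"

text \<open>\<open>C\<close> is a face of \<open>D\<close>: \<open>D\<close> is cut into nonempty runs of consecutive blocks, and each run
  is merged into one block of \<open>C\<close>.\<close>

definition merges_to :: "nat set list \<Rightarrow> nat set list \<Rightarrow> bool" where
  "merges_to D C \<longleftrightarrow>
     (\<exists>Dss. concat Dss = D \<and> [] \<notin> set Dss \<and> C = map (\<lambda>Ds. \<Union>(set Ds)) Dss)"

text \<open>The vertices are the ordered partitions with two blocks. For \<open>D = (C\<^sub>1, \<dots>, C\<^sub>r)\<close> there are
  \<open>r - 1\<close> vertices below \<open>D\<close>, namely the \<open>(C\<^sub>1 \<union> \<dots> \<union> C\<^sub>i, C\<^bsub>i+1\<^esub> \<union> \<dots> \<union> C\<^sub>r)\<close>; they determine \<open>D\<close>.\<close>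

definition face_vertices :: "nat set list \<Rightarrow> nat set list set" where
  "face_vertices D = {C. length C = 2 \<and> merges_to D C}"

definition Lambda_faces :: "nat \<Rightarrow> nat multiset \<Rightarrow> nat \<Rightarrow> nat set list set" where
  "Lambda_faces n lam m =
     {C \<in> ordered_partitions n. (set (butlast C), last C) \<in> pointed_filter n lam m}"

definition Lambda_complex :: "nat \<Rightarrow> nat multiset \<Rightarrow> nat \<Rightarrow> nat set list set set" where
  "Lambda_complex n lam m = face_vertices ` Lambda_faces n lam m"

end

theory Submission imports Defs begin

text \<open>
  Write \<open>P\<close> for the filter without its top. Forgetting the order of the blocks is an antitone map
  \<open>f\<close> from the nonempty faces of \<open>\<Lambda>\<close> to \<open>P\<close>. In the other direction, \<open>\<pi> \<mapsto> ([n] - Z, Z)\<close>, with \<open>Z\<close> the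
  pointed block of \<open>\<pi>\<close>, is a simplicial map \<open>a\<close> from \<open>\<Delta>(P)\<close> to \<open>\<Lambda>\<close>: along a chain the
  pointed blocks increase, and the ordered partition they cut out is coarser than the least element
  of the chain. The vertex \<open>a(f(D))\<close> is always the last vertex of \<open>D\<close>, so \<open>a \<circ> f\<close> from \<open>sd \<Lambda>\<close>
  to \<open>\<Lambda>\<close> is homotopic to the canonical homeomorphism. For a chain \<open>c\<close> we have
  \<open>min c \<le> f(a(c))\<close>, so that \<open>f \<circ> a\<close> from \<open>sd \<Delta>(P)\<close> to \<open>\<Delta>(P)\<close> is homotopic to
  \<open>c \<mapsto> min c\<close>, which is again homotopic to the canonical homeomorphism. Hence \<open>f\<close> has a left and a
  right homotopy inverse. All homotopies are straight-line homotopies between maps that send each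
  point into a common simplex.
\<close>

section \<open>Maps between geometric realizations\<close>

definition finite_complex :: "'a set set \<Rightarrow> bool" where
  "finite_complex K \<longleftrightarrow> finite K \<and> (\<forall>s\<in>K. finite s) \<and> (\<forall>s\<in>K. \<forall>t\<subseteq>s. t \<in> K)"

definition supp :: "('a \<Rightarrow> real) \<Rightarrow> 'a set" where
  "supp x = {v. x v \<noteq> 0}"

abbreviation points :: "'a set set \<Rightarrow> ('a \<Rightarrow> real) set" where
  "points K \<equiv> topspace (geometric_realization K)"

lemma finite_complex_vertices: "finite_complex K \<Longrightarrow> finite (\<Union>K)"
  by (auto simp: finite_complex_def)

lemma finite_complex_subset: "finite_complex K \<Longrightarrow> s \<in> K \<Longrightarrow> t \<subseteq> s \<Longrightarrow> t \<in> K"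
  by (auto simp: finite_complex_def)

lemma geometric_realization_eq: "geometric_realization K = top_of_set (points K)"
  by (simp add: geometric_realization_def)

text \<open>As \<open>K\<close> is closed under subsets, the witnessing face can be shrunk to the
  support, so that later arguments mention only \<open>supp x\<close>.\<close>

lemma points_iff:
  assumes "finite_complex K"
  shows "x \<in> points K \<longleftrightarrow> (\<forall>v. 0 \<le> x v) \<and> supp x \<in> K \<and> sum x (supp x) = 1"
proof -
  have "sum x s = sum x (supp x)" if "s \<in> K" "supp x \<subseteq> s" for s
    using that assms by (intro sum.mono_neutral_right) (auto simp: finite_complex_def supp_def)
  then have "(\<exists>s\<in>K. supp x \<subseteq> s \<and> sum x s = 1) \<longleftrightarrow> supp x \<in> K \<and> sum x (supp x) = 1"
    using finite_complex_subset[OF assms] by (metis order_refl)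
  then show ?thesis
    by (simp add: geometric_realization_def supp_def)
qed

lemma points_supp:
  assumes "finite_complex K" "x \<in> points K"
  shows "supp x \<in> K" "supp x \<noteq> {}" "finite (supp x)" "\<And>v. 0 \<le> x v" "\<And>v. v \<in> supp x \<Longrightarrow> 0 < x v"
proof -
  have *: "\<And>v. 0 \<le> x v" "supp x \<in> K" "sum x (supp x) = 1"
    using assms points_iff by blast+
  show "supp x \<in> K" "\<And>v. 0 \<le> x v"
    using * by auto
  show "supp x \<noteq> {}"
    using *(3) by auto
  show "finite (supp x)"
    using *(2) assms by (auto simp: finite_complex_def)
  show "\<And>v. v \<in> supp x \<Longrightarrow> 0 < x v"
    using *(1) by (metis (mono_tags) less_eq_real_def mem_Collect_eq supp_def)
qed

lemma sum_eq_1_supp_subset: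
  assumes "finite_complex K" "x \<in> points K" "finite s" "supp x \<subseteq> s"
  shows "sum x s = 1"
proof -
  have "sum x s = sum x (supp x)"
    using assms(3,4) by (intro sum.mono_neutral_right) (auto simp: supp_def)
  then show ?thesis
    using assms(1,2) points_iff by metis
qed

section \<open>Homotopies through a common simplex\<close>

text \<open>Stated for maps of spaces rather than for vertex maps, so that it also applies to
  composites and to maps that are not simplicial, such as \<open>subdivide\<close>.\<close>

definition contiguous :: "'a topology \<Rightarrow> 'b set set \<Rightarrow> ('a \<Rightarrow> 'b \<Rightarrow> real) \<Rightarrow> ('a \<Rightarrow> 'b \<Rightarrow> real) \<Rightarrow> bool" where
  "contiguous X L f g \<longleftrightarrow> (\<forall>x\<in>topspace X. \<exists>s\<in>L. supp (f x) \<subseteq> s \<and> supp (g x) \<subseteq> s)"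

text \<open>The segment from \<open>f x\<close> to \<open>g x\<close> stays in the simplex that
  contains both, so the straight-line homotopy never leaves the realization.\<close>

lemma homotopic_if_contiguous:
  assumes L: "finite_complex L" and f: "continuous_map X (geometric_realization L) f"
    and g: "continuous_map X (geometric_realization L) g" and con: "contiguous X L f g"
  shows "homotopic_with (\<lambda>_. True) X (geometric_realization L) f g"
proof -
  define h :: "real \<times> _ \<Rightarrow> _" where "h = (\<lambda>(t, x) v. (1 - t) * f x v + t * g x v)"
  let ?Y = "prod_topology (top_of_set {0..1::real}) X"
  have coord: "continuous_map X euclidean (\<lambda>x. k x v)"
    if "continuous_map X (geometric_realization L) k" for k v
  proof -
    have "continuous_map X euclidean k"
      using that by (simp add: geometric_realization_def continuous_map_in_subtopology)
    then have "continuous_map X euclidean ((\<lambda>x. x v) \<circ> k)"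
      by (rule continuous_map_compose) simp
    then show ?thesis by (simp add: o_def)
  qed
  have fst': "continuous_map ?Y euclideanreal fst"
    using continuous_map_fst continuous_map_into_fulltopology by blast
  have snd': "continuous_map ?Y euclideanreal (\<lambda>p. k (snd p) v)"
    if "continuous_map X (geometric_realization L) k" for k v
    using continuous_map_compose[OF continuous_map_snd coord[OF that, of v]] by (simp add: o_def)
  have "continuous_map ?Y euclideanreal (\<lambda>p. (1 - fst p) * f (snd p) v + fst p * g (snd p) v)" for v
  proof (rule continuous_map_add)
    have "continuous_map ?Y euclideanreal (\<lambda>p. 1 - fst p)"
      using continuous_map_diff[OF continuous_map_const[THEN iffD2] fst', of 1] by simp
    then show "continuous_map ?Y euclideanreal (\<lambda>p. (1 - fst p) * f (snd p) v)"
      using snd'[OF f] by (rule continuous_map_real_mult)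
    show "continuous_map ?Y euclideanreal (\<lambda>p. fst p * g (snd p) v)"
      using fst' snd'[OF g] by (rule continuous_map_real_mult)
  qed
  then have "continuous_map ?Y euclideanreal (\<lambda>p. h p v)" for v
    by (simp add: h_def case_prod_beta)
  \<comment> \<open>Functions carry the product topology, so continuity in each coordinate
    suffices.\<close>
  then have cont: "continuous_map ?Y euclidean h"
    unfolding euclidean_product_topology[symmetric] by (simp add: continuous_map_componentwise_UNIV)
  have "h p \<in> points L" if p: "p \<in> topspace ?Y" for p
  proof -
    obtain t x where tx: "p = (t, x)" "0 \<le> t" "t \<le> 1" "x \<in> topspace X"
      using p by (cases p) auto
    have fx: "f x \<in> points L" and gx: "g x \<in> points L"
      using f g tx(4) by (auto dest!: continuous_map_funspace)
    obtain s where s: "s \<in> L" "supp (f x) \<subseteq> s" "supp (g x) \<subseteq> s"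
      using con tx(4) unfolding contiguous_def by blast
    have fin: "finite s"
      using s L by (auto simp: finite_complex_def)
    have "0 \<le> h p v" for v
      using points_supp(4)[OF L fx, of v] points_supp(4)[OF L gx, of v] tx by (simp add: h_def)
    moreover have "supp (h p) \<subseteq> s"
    proof -
      have "f x v = 0 \<and> g x v = 0" if "v \<notin> s" for v
        using s(2,3) that by (auto simp: supp_def)
      then show ?thesis
        by (force simp: h_def tx supp_def)
    qed
    moreover have "sum (h p) s = 1"
      using sum_eq_1_supp_subset[OF L fx fin s(2)] sum_eq_1_supp_subset[OF L gx fin s(3)]
      by (simp add: h_def tx sum.distrib flip: sum_distrib_left)
    ultimately show ?thesis
      using s(1) by (auto simp: geometric_realization_def supp_def)
  qed
  then have "continuous_map ?Y (geometric_realization L) h"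
    using cont by (subst geometric_realization_eq) (auto simp: continuous_map_in_subtopology)
  then show ?thesis
    unfolding homotopic_with_def by (intro exI[of _ h]) (auto simp: h_def)
qed

text \<open>Both \<open>L\<close> and \<open>R\<close> are homotopic to
  \<open>L \<circ> F \<circ> R\<close>, hence to each other, and the left inverse becomes
  two-sided.\<close>

lemma homotopy_equivalence_if_inverses:
  assumes F: "continuous_map X Y F" and Lc: "continuous_map Y X L" and Rc: "continuous_map Y X R"
    and L: "homotopic_with (\<lambda>_. True) X X (L \<circ> F) id"
    and R: "homotopic_with (\<lambda>_. True) Y Y (F \<circ> R) id"
  shows "X homotopy_equivalent_space Y"
proof -
  have "homotopic_with (\<lambda>_. True) Y X ((L \<circ> F) \<circ> R) (id \<circ> R)"
    using L Rc by (rule homotopic_with_compose_continuous_map_right) simp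
  moreover have "homotopic_with (\<lambda>_. True) Y X (L \<circ> (F \<circ> R)) (L \<circ> id)"
    using R Lc by (rule homotopic_with_compose_continuous_map_left) simp
  ultimately have "homotopic_with (\<lambda>_. True) Y X L R"
    by (metis comp_assoc comp_id id_comp homotopic_with_symD homotopic_with_trans)
  then have "homotopic_with (\<lambda>_. True) Y Y (F \<circ> L) (F \<circ> R)"
    using F by (rule homotopic_with_compose_continuous_map_left) simp
  then have "homotopic_with (\<lambda>_. True) Y Y (F \<circ> L) id"
    using R homotopic_with_trans by blast
  then show ?thesis
    unfolding homotopy_equivalent_space_def using F Lc L by blast
qed

section \<open>Maps given by normalized weights\<close>

text \<open>Turns nonnegative weights into barycentric coordinates. Points are functions on the
  whole type, hence the value zero off \<open>W\<close>.\<close>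

definition normalize_on :: "'a set \<Rightarrow> ('a \<Rightarrow> real) \<Rightarrow> 'a \<Rightarrow> real" where
  "normalize_on W T w = (if w \<in> W then T w / sum T W else 0)"

lemma supp_normalize_on:
  assumes "finite W" "\<And>w. w \<in> W \<Longrightarrow> 0 \<le> T w" "w \<in> W" "0 < T w"
  shows "supp (normalize_on W T) = {w\<in>W. T w \<noteq> 0}" and "sum T W > 0"
proof -
  show "sum T W > 0"
    using assms by (intro sum_pos2) auto
  then show "supp (normalize_on W T) = {w\<in>W. T w \<noteq> 0}"
    by (auto simp: supp_def normalize_on_def)
qed

text \<open>Each coordinate is a quotient of continuous functions whose denominator is kept positive
  by \<open>nonneg\<close> and \<open>pos\<close>; \<open>face\<close> puts the support of the image
  into \<open>L\<close>.\<close>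

lemma continuous_map_normalize_on:
  assumes L: "finite_complex L" and W: "finite W"
    and cont: "\<And>w. w \<in> W \<Longrightarrow> continuous_on (points K) (\<lambda>x. T x w)"
    and nonneg: "\<And>x w. x \<in> points K \<Longrightarrow> w \<in> W \<Longrightarrow> 0 \<le> T x w"
    and pos: "\<And>x. x \<in> points K \<Longrightarrow> \<exists>w\<in>W. 0 < T x w"
    and face: "\<And>x. x \<in> points K \<Longrightarrow> {w\<in>W. T x w \<noteq> 0} \<in> L"
  shows "continuous_map (geometric_realization K) (geometric_realization L)
           (\<lambda>x. normalize_on W (T x))"
proof -
  have sum_pos: "sum (T x) W > 0" and supp: "supp (normalize_on W (T x)) = {w\<in>W. T x w \<noteq> 0}"
    if "x \<in> points K" for x
    using supp_normalize_on[OF W, of "T x"] nonneg[OF that] pos[OF that] by blast+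
  have "continuous_on (points K) (\<lambda>x. normalize_on W (T x) w)" for w
  proof (cases "w \<in> W")
    case True
    have "sum (T x) W \<noteq> 0" if "x \<in> points K" for x
      using sum_pos[OF that] by simp
    then show ?thesis
      using True by (auto simp: normalize_on_def intro!: continuous_intros cont)
  qed (simp add: normalize_on_def)
  moreover have "normalize_on W (T x) \<in> points L" if x: "x \<in> points K" for x
    unfolding points_iff[OF L]
  proof (intro conjI allI)
    show "0 \<le> normalize_on W (T x) v" for v
      using nonneg[OF x] sum_pos[OF x] by (simp add: normalize_on_def)
    show "supp (normalize_on W (T x)) \<in> L"
      using face[OF x] supp[OF x] by simp
    have "sum (normalize_on W (T x)) (supp (normalize_on W (T x))) = sum (normalize_on W (T x)) W"
      using W supp[OF x] by (intro sum.mono_neutral_left) (auto simp: normalize_on_def)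
    also have "\<dots> = sum (T x) W / sum (T x) W"
      by (simp add: normalize_on_def flip: sum_divide_distrib)
    finally show "sum (normalize_on W (T x)) (supp (normalize_on W (T x))) = 1"
      using sum_pos[OF x] by simp
  qed
  ultimately show ?thesis
    by (subst (1 2) geometric_realization_eq)
      (auto intro!: continuous_on_coordinatewise_then_product simp del: topspace_euclidean_subtopology)
qed

lemma continuous_on_coordinate: "continuous_on A (\<lambda>x. x v :: real)"
  by (rule continuous_on_subset[OF continuous_on_product_coordinates]) simp

text \<open>Before normalization, a vertex passes its full coordinate to every related vertex.
  Simplicial maps and the map from a subdivision back to the complex are both of this form.\<close>

definition spread :: "'a set set \<Rightarrow> 'b set set \<Rightarrow> ('a \<Rightarrow> 'b \<Rightarrow> bool) \<Rightarrow> ('a \<Rightarrow> real) \<Rightarrow> 'b \<Rightarrow> real" where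
  "spread K L R x = normalize_on (\<Union>L) (\<lambda>w. \<Sum>v | v \<in> \<Union>K \<and> R v w. x v)"

context
  fixes K :: "'a set set" and L :: "'b set set" and R :: "'a \<Rightarrow> 'b \<Rightarrow> bool"
  assumes K: "finite_complex K" and L: "finite_complex L"
    and R: "\<And>s. s \<in> K \<Longrightarrow> s \<noteq> {} \<Longrightarrow> {w\<in>\<Union>L. \<exists>v\<in>s. R v w} \<in> L - {{}}"
begin

text \<open>Nonnegative coordinates cannot cancel, so the support of the image depends only on the
  relation and on \<open>supp x\<close>.\<close>

lemma spread_weight:
  assumes x: "x \<in> points K"
  shows "0 \<le> (\<Sum>v | v \<in> \<Union>K \<and> R v w. x v)"
    and "(\<Sum>v | v \<in> \<Union>K \<and> R v w. x v) \<noteq> 0 \<longleftrightarrow> (\<exists>v\<in>supp x. R v w)"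
proof -
  note px = points_supp[OF K x]
  have fin: "finite {v \<in> \<Union>K. R v w}"
    using finite_complex_vertices[OF K] by (rule rev_finite_subset) auto
  show "0 \<le> (\<Sum>v | v \<in> \<Union>K \<and> R v w. x v)"
    using px(4) by (simp add: sum_nonneg)
  show "(\<Sum>v | v \<in> \<Union>K \<and> R v w. x v) \<noteq> 0 \<longleftrightarrow> (\<exists>v\<in>supp x. R v w)"
  proof -
    have "(\<Sum>v | v \<in> \<Union>K \<and> R v w. x v) \<noteq> 0 \<longleftrightarrow> (\<exists>v\<in>{v\<in>\<Union>K. R v w}. v \<in> supp x)"
      using px(4) fin by (subst sum_nonneg_eq_0_iff) (simp_all add: supp_def)
    then show ?thesis
      using px(1) by blast
  qed
qed

lemma spread_ex:
  assumes x: "x \<in> points K"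
  shows "\<exists>w\<in>\<Union>L. 0 < (\<Sum>v | v \<in> \<Union>K \<and> R v w. x v)"
proof -
  obtain w where w: "w \<in> \<Union>L" "\<exists>v\<in>supp x. R v w"
    using R[of "supp x"] points_supp(1,2)[OF K x] by blast
  then show ?thesis
    using spread_weight[OF x, of w] by (intro bexI[of _ w]) linarith+
qed

lemma supp_spread:
  assumes x: "x \<in> points K"
  shows "supp (spread K L R x) = {w\<in>\<Union>L. \<exists>v\<in>supp x. R v w}"
proof -
  obtain w where "w \<in> \<Union>L" "0 < (\<Sum>v | v \<in> \<Union>K \<and> R v w. x v)"
    using spread_ex[OF x] by blast
  then show ?thesis
    unfolding spread_def using finite_complex_vertices[OF L] spread_weight[OF x]
    by (subst supp_normalize_on(1)) auto
qed

lemma continuous_map_spread: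
  "continuous_map (geometric_realization K) (geometric_realization L) (spread K L R)"
  unfolding spread_def
proof (rule continuous_map_normalize_on[OF L finite_complex_vertices[OF L]])
  fix x assume x: "x \<in> points K"
  show "{w \<in> \<Union>L. (\<Sum>v | v \<in> \<Union>K \<and> R v w. x v) \<noteq> 0} \<in> L"
    using R[of "supp x"] points_supp[OF K x] spread_weight[OF x] by simp
qed (use spread_weight spread_ex in \<open>auto intro!: continuous_intros continuous_on_coordinate\<close>)

end

text \<open>For finite complexes and a \<open>\<phi>\<close> that takes faces to faces, the weights
  already sum to one; normalization then changes nothing, and this is the usual affine
  extension.\<close>

definition simplicial_map :: "'a set set \<Rightarrow> 'b set set \<Rightarrow> ('a \<Rightarrow> 'b) \<Rightarrow> ('a \<Rightarrow> real) \<Rightarrow> 'b \<Rightarrow> real" where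
  "simplicial_map K L \<phi> = spread K L (\<lambda>v w. w = \<phi> v)"

lemma simplicial_map:
  assumes K: "finite_complex K" and L: "finite_complex L"
    and \<phi>: "\<And>s. s \<in> K \<Longrightarrow> s \<noteq> {} \<Longrightarrow> \<phi> ` s \<in> L"
  shows continuous_map_simplicial_map:
      "continuous_map (geometric_realization K) (geometric_realization L) (simplicial_map K L \<phi>)"
    and supp_simplicial_map: "\<And>x. x \<in> points K \<Longrightarrow> supp (simplicial_map K L \<phi> x) = \<phi> ` supp x"
proof -
  have *: "{w\<in>\<Union>L. \<exists>v\<in>s. w = \<phi> v} = \<phi> ` s" if "s \<in> K" "s \<noteq> {}" for s
    using \<phi>[OF that] by auto
  then have R: "{w\<in>\<Union>L. \<exists>v\<in>s. w = \<phi> v} \<in> L - {{}}" if "s \<in> K" "s \<noteq> {}" for s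
    using \<phi> that by simp
  show "continuous_map (geometric_realization K) (geometric_realization L) (simplicial_map K L \<phi>)"
    unfolding simplicial_map_def by (rule continuous_map_spread[OF K L R])
  show "supp (simplicial_map K L \<phi> x) = \<phi> ` supp x" if "x \<in> points K" for x
    using supp_spread[OF K L R that] *[OF points_supp(1,2)[OF K that]] by (simp add: simplicial_map_def)
qed

section \<open>Chains and order complexes\<close>

lemma finite_complex_order_complex: "finite P \<Longrightarrow> finite_complex (order_complex P le)"
  by (auto simp: finite_complex_def order_complex_def chain_subset finite_subset)

lemma finite_complex_sd: "finite_complex K \<Longrightarrow> finite_complex (barycentric_subdivision K)"
  unfolding barycentric_subdivision_def
  by (rule finite_complex_order_complex) (simp add: finite_complex_def)

text \<open>The direction of the comparison in the image is left open, so that monotone and antitone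
  maps are covered alike.\<close>

lemma order_complex_image:
  assumes "c \<in> order_complex P le" "\<And>p. p \<in> P \<Longrightarrow> \<phi> p \<in> Q"
    and "\<And>p q. p \<in> P \<Longrightarrow> q \<in> P \<Longrightarrow> le p q \<Longrightarrow> le' (\<phi> p) (\<phi> q) \<or> le' (\<phi> q) (\<phi> p)"
  shows "\<phi> ` c \<in> order_complex Q le'"
  using assms unfolding order_complex_def chain_def by blast

lemma chain_subset_Max:
  assumes "finite c" "c \<noteq> {}" "Complete_Partial_Order.chain (\<subseteq>) c"
  shows "\<Union>c \<in> c"
  using assms
proof (induction c rule: finite_ne_induct)
  case (insert s c)
  then have "\<Union>c \<in> c"
    by (simp add: chain_def)
  then have "s \<subseteq> \<Union>c \<or> \<Union>c \<subseteq> s"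
    using insert.prems unfolding chain_def by (metis insertCI)
  then show ?case
    using \<open>\<Union>c \<in> c\<close> by (auto simp: Un_absorb1 Un_absorb2)
qed simp

text \<open>The largest member of a chain of faces is its union; it is the simplex of
  \<open>K\<close> that carries the simplex \<open>c\<close> of the subdivision.\<close>

lemma Union_sd_face:
  assumes "c \<in> barycentric_subdivision K" "c \<noteq> {}"
  shows "\<Union>c \<in> c" "\<Union>c \<in> K - {{}}"
  using assms chain_subset_Max[of c]
  unfolding barycentric_subdivision_def order_complex_def by blast+

section \<open>Barycentric subdivision\<close>

lemma order_complex_Un:
  assumes "c \<in> order_complex P le" "d \<in> order_complex P le"
    and "\<And>p q. p \<in> c \<Longrightarrow> q \<in> d \<Longrightarrow> le p q \<or> le q p"
  shows "c \<union> d \<in> order_complex P le"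
proof -
  have "Complete_Partial_Order.chain le (c \<union> d)"
  proof (rule chainI)
    fix p q assume "p \<in> c \<union> d" "q \<in> c \<union> d"
    then show "le p q \<or> le q p"
      using assms(3)[of p q] assms(3)[of q p] assms(1,2)
      by (auto simp: order_complex_def dest: chainD)
  qed
  then show ?thesis
    using assms(1,2) by (simp add: order_complex_def)
qed

text \<open>The weight of \<open>s\<close> is positive iff \<open>s\<close> is a superlevel set of \<open>x\<close> at a positive level; such
  sets form a chain.\<close>

definition level_weight :: "'a set \<Rightarrow> ('a \<Rightarrow> real) \<Rightarrow> 'a set \<Rightarrow> real" where
  "level_weight V x s = (\<Prod>v\<in>s. x v) * (\<Prod>v\<in>s. \<Prod>w\<in>V - s. max 0 (x v - x w))"

definition level_sets :: "('a \<Rightarrow> real) \<Rightarrow> 'a set set" where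
  "level_sets x = {s. s \<noteq> {} \<and> s \<subseteq> supp x \<and> (\<forall>v\<in>s. \<forall>w. w \<notin> s \<longrightarrow> x w < x v)}"

text \<open>A vertex in \<open>s - t\<close> and a vertex in \<open>t - s\<close> would each need
  the strictly larger coordinate.\<close>

lemma chain_level_sets: "Complete_Partial_Order.chain (\<subseteq>) (level_sets x)"
proof (rule chainI, rule ccontr)
  fix s t assume *: "s \<in> level_sets x" "t \<in> level_sets x" "\<not> (s \<subseteq> t \<or> t \<subseteq> s)"
  then obtain v w where "v \<in> s" "v \<notin> t" "w \<in> t" "w \<notin> s"
    by blast
  then have "x w < x v" "x v < x w"
    using * by (auto simp: level_sets_def)
  then show False by simp
qed

text \<open>The inverse of the canonical homeomorphism has the same support at every point of a
  finite complex. The weights chosen here are other ones, built from products and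
  \<open>max\<close>, so that continuity is immediate and no coordinates have to be sorted.\<close>

definition subdivide :: "'a set set \<Rightarrow> ('a \<Rightarrow> real) \<Rightarrow> 'a set \<Rightarrow> real" where
  "subdivide K x = normalize_on (K - {{}}) (level_weight (\<Union>K) x)"

context
  fixes K :: "'a set set" assumes K: "finite_complex K"
begin

lemma level_weight_nonneg: "x \<in> points K \<Longrightarrow> 0 \<le> level_weight V x s"
  unfolding level_weight_def using points_supp(4)[OF K]
  by (intro mult_nonneg_nonneg prod_nonneg) auto

lemma level_weight_nonzero:
  assumes x: "x \<in> points K"
  shows "{s\<in>K - {{}}. level_weight (\<Union>K) x s \<noteq> 0} = level_sets x"
proof -
  note px = points_supp[OF K x]
  \<comment> \<open>The weight compares \<open>s\<close> only with vertices of \<open>K\<close>,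
    whereas \<open>level_sets\<close> compares it with the whole type; the remaining coordinates
    vanish.\<close>
  have out: "x w = 0" if "w \<notin> \<Union>K" for w
    using px(1) that by (auto simp: supp_def)
  have "level_weight (\<Union>K) x s \<noteq> 0 \<longleftrightarrow> s \<in> level_sets x" if s: "s \<in> K - {{}}" for s
  proof -
    have fin: "finite s" "finite (\<Union>K - s)"
      using s K finite_complex_vertices[OF K] by (auto simp: finite_complex_def)
    have "level_weight (\<Union>K) x s \<noteq> 0 \<longleftrightarrow>
        (\<forall>v\<in>s. x v \<noteq> 0) \<and> (\<forall>v\<in>s. \<forall>w\<in>\<Union>K - s. max 0 (x v - x w) \<noteq> 0)"
      unfolding level_weight_def using fin by (simp add: prod_zero_iff)
    also have "\<dots> \<longleftrightarrow> (\<forall>v\<in>s. x v \<noteq> 0) \<and> (\<forall>v\<in>s. \<forall>w\<in>\<Union>K - s. x w < x v)"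
    proof -
      have "max 0 (x v - x w) \<noteq> 0 \<longleftrightarrow> x w < x v" for v w
        by (auto simp: max_def)
      then show ?thesis by simp
    qed
    also have "\<dots> \<longleftrightarrow> s \<in> level_sets x"
    proof
      assume *: "(\<forall>v\<in>s. x v \<noteq> 0) \<and> (\<forall>v\<in>s. \<forall>w\<in>\<Union>K - s. x w < x v)"
      then have pos: "0 < x v" if "v \<in> s" for v
        using px(4)[of v] that by (simp add: less_le)
      have "x w < x v" if "v \<in> s" "w \<notin> s" for v w
      proof (cases "w \<in> \<Union>K")
        case True
        then show ?thesis using * that by blast
      next
        case False
        then show ?thesis using out[of w] pos that by simp
      qed
      moreover have "s \<subseteq> supp x"
        using pos by (force simp: supp_def)
      ultimately show "s \<in> level_sets x"
        using s by (auto simp: level_sets_def)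
    next
      assume "s \<in> level_sets x"
      then show "(\<forall>v\<in>s. x v \<noteq> 0) \<and> (\<forall>v\<in>s. \<forall>w\<in>\<Union>K - s. x w < x v)"
        by (auto simp: level_sets_def supp_def)
    qed
    finally show ?thesis .
  qed
  moreover have "level_sets x \<subseteq> K - {{}}"
    using px(1) finite_complex_subset[OF K] by (auto simp: level_sets_def)
  ultimately show ?thesis by blast
qed

lemma level_sets_subset: "x \<in> points K \<Longrightarrow> level_sets x \<subseteq> K - {{}}"
  using level_weight_nonzero by blast

lemma level_sets_nonempty:
  assumes x: "x \<in> points K"
  shows "level_sets x \<noteq> {}"
proof -
  note px = points_supp[OF K x]
  \<comment> \<open>The support is the superlevel set at the least positive coordinate.\<close>
  have "supp x \<in> level_sets x"
    using px unfolding level_sets_def supp_def by auto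
  then show ?thesis by auto
qed

lemma level_sets_mem_sd: "x \<in> points K \<Longrightarrow> level_sets x \<in> barycentric_subdivision K"
  using level_sets_subset chain_level_sets K
  by (auto simp: barycentric_subdivision_def order_complex_def finite_complex_def
      intro: finite_subset[of _ K])

lemma level_weight_ex: "x \<in> points K \<Longrightarrow> \<exists>s\<in>K - {{}}. 0 < level_weight (\<Union>K) x s"
  using level_sets_nonempty level_weight_nonzero level_weight_nonneg
  by (metis (mono_tags, lifting) all_not_in_conv less_eq_real_def mem_Collect_eq)

lemma supp_subdivide:
  assumes x: "x \<in> points K"
  shows "supp (subdivide K x) = level_sets x"
proof -
  obtain s where "s \<in> K - {{}}" "0 < level_weight (\<Union>K) x s"
    using level_weight_ex[OF x] by blast
  then show ?thesis
    unfolding subdivide_def level_weight_nonzero[OF x, symmetric] using K level_weight_nonneg[OF x]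
    by (intro supp_normalize_on(1)) (auto simp: finite_complex_def)
qed

lemma continuous_map_subdivide:
  "continuous_map (geometric_realization K) (geometric_realization (barycentric_subdivision K))
     (subdivide K)"
  unfolding subdivide_def
proof (rule continuous_map_normalize_on[OF finite_complex_sd[OF K]])
  show "continuous_on (points K) (\<lambda>x. level_weight (\<Union>K) x s)" for s
    unfolding level_weight_def by (intro continuous_intros continuous_on_coordinate)
qed (use K level_weight_nonneg level_weight_ex level_weight_nonzero level_sets_mem_sd in
    \<open>auto simp: finite_complex_def\<close>)

text \<open>The canonical homeomorphism, precomposed with the normalized rescaling of each coordinate
  \<open>y s\<close> by \<open>card s\<close>.\<close>

definition unsubdivide :: "('a set \<Rightarrow> real) \<Rightarrow> 'a \<Rightarrow> real" where
  "unsubdivide = spread (barycentric_subdivision K) K (\<lambda>s v. v \<in> s)"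

lemma unsubdivide_face:
  assumes "c \<in> barycentric_subdivision K" "c \<noteq> {}"
  shows "{v\<in>\<Union>K. \<exists>s\<in>c. v \<in> s} \<in> K - {{}}"
proof -
  have "\<Union>c \<subseteq> \<Union>K"
    using Union_sd_face(2)[OF assms] by (intro Union_upper) simp
  then have "{v\<in>\<Union>K. \<exists>s\<in>c. v \<in> s} = \<Union>c"
    by auto
  then show ?thesis
    using Union_sd_face[OF assms] by simp
qed

lemma continuous_map_unsubdivide:
  "continuous_map (geometric_realization (barycentric_subdivision K)) (geometric_realization K)
     unsubdivide"
  unfolding unsubdivide_def
  by (rule continuous_map_spread[where R = "\<lambda>s v. v \<in> s", OF finite_complex_sd[OF K] K unsubdivide_face])

lemma supp_unsubdivide:
  assumes y: "y \<in> points (barycentric_subdivision K)"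
  shows "supp (unsubdivide y) = \<Union>(supp y)"
proof -
  note py = points_supp(1,2)[OF finite_complex_sd[OF K] y]
  have "\<Union>(supp y) \<subseteq> \<Union>K"
    using Union_sd_face(2)[OF py] by (intro Union_upper) simp
  then have "{v\<in>\<Union>K. \<exists>s\<in>supp y. v \<in> s} = \<Union>(supp y)"
    by auto
  then show ?thesis
    unfolding unsubdivide_def
    using supp_spread[where R = "\<lambda>s v. v \<in> s", OF finite_complex_sd[OF K] K unsubdivide_face y]
    by simp
qed

text \<open>All superlevel sets lie in \<open>supp x\<close>, so the composite keeps each point in
  its own simplex.\<close>

lemma unsubdivide_subdivide:
  "homotopic_with (\<lambda>_. True) (geometric_realization K) (geometric_realization K)
     (unsubdivide \<circ> subdivide K) id"
proof (rule homotopic_if_contiguous[OF K])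
  show "continuous_map (geometric_realization K) (geometric_realization K)
      (unsubdivide \<circ> subdivide K)"
    by (rule continuous_map_compose[OF continuous_map_subdivide continuous_map_unsubdivide])
  show "contiguous (geometric_realization K) K (unsubdivide \<circ> subdivide K) id"
    unfolding contiguous_def
  proof
    fix x assume x: "x \<in> points K"
    have "subdivide K x \<in> points (barycentric_subdivision K)"
      using continuous_map_subdivide x by (auto dest: continuous_map_funspace)
    then have "supp (unsubdivide (subdivide K x)) \<subseteq> supp x"
      using supp_unsubdivide supp_subdivide[OF x] by (auto simp: level_sets_def)
    then show "\<exists>s\<in>K. supp ((unsubdivide \<circ> subdivide K) x) \<subseteq> s \<and> supp (id x) \<subseteq> s"
      using points_supp(1)[OF K x] by auto
  qed
qed simp

text \<open>In the chain \<open>supp y\<close>, a set that contains \<open>v\<close> is not below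
  \<open>u\<close>, hence contains \<open>u\<close> and with it \<open>w\<close>. So
  \<open>w\<close> collects every weight that \<open>v\<close> collects.\<close>

lemma unsubdivide_le:
  assumes y: "y \<in> points (barycentric_subdivision K)" and u: "u \<in> supp y" "w \<in> u" "v \<notin> u"
  shows "unsubdivide y v \<le> unsubdivide y w"
proof -
  note sdK = finite_complex_sd[OF K]
  note py = points_supp[OF sdK y]
  have chain: "Complete_Partial_Order.chain (\<subseteq>) (supp y)"
    using py(1) by (simp add: barycentric_subdivision_def order_complex_def)
  let ?T = "\<lambda>v. \<Sum>s | s \<in> \<Union>(barycentric_subdivision K) \<and> v \<in> s. y s"
  have "?T v = (\<Sum>s | s \<in> supp y \<and> v \<in> s. y s)" for v
    using py(1) by (intro sum.mono_neutral_right
        rev_finite_subset[OF finite_complex_vertices[OF sdK]]) (auto simp: supp_def)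
  moreover have "(\<Sum>s | s \<in> supp y \<and> v \<in> s. y s) \<le> (\<Sum>s | s \<in> supp y \<and> w \<in> s. y s)"
  proof (rule sum_mono2)
    have "w \<in> s" if "s \<in> supp y" "v \<in> s" for s
      using that u chainD[OF chain, of s u] by blast
    then show "{s \<in> supp y. v \<in> s} \<subseteq> {s \<in> supp y. w \<in> s}"
      by blast
  qed (use py in auto)
  ultimately have "?T v \<le> ?T w"
    by simp
  \<comment> \<open>Normalized weights vanish off the vertex set, so \<open>w\<close> has to be a
    vertex; for \<open>v\<close> the value zero does no harm, because the weights are
    nonnegative.\<close>
  moreover have "w \<in> \<Union>K"
    using u py(1) by (auto simp: barycentric_subdivision_def order_complex_def)
  moreover have "0 \<le> sum ?T (\<Union>K)" "0 \<le> ?T w"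
    using py(4) by (auto intro!: sum_nonneg)
  ultimately show ?thesis
    unfolding unsubdivide_def spread_def normalize_on_def by (auto intro: divide_right_mono)
qed

text \<open>The superlevel sets of the image of \<open>y\<close> are comparable with all members of
  \<open>supp y\<close>, so both chains lie in one simplex of the subdivision.\<close>

lemma subdivide_unsubdivide:
  "homotopic_with (\<lambda>_. True) (geometric_realization (barycentric_subdivision K))
     (geometric_realization (barycentric_subdivision K)) (subdivide K \<circ> unsubdivide) id"
proof (rule homotopic_if_contiguous[OF finite_complex_sd[OF K]])
  let ?sd = "barycentric_subdivision K"
  show "continuous_map (geometric_realization ?sd) (geometric_realization ?sd)
      (subdivide K \<circ> unsubdivide)"
    by (rule continuous_map_compose[OF continuous_map_unsubdivide continuous_map_subdivide])
  show "contiguous (geometric_realization ?sd) ?sd (subdivide K \<circ> unsubdivide) id"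
    unfolding contiguous_def
  proof
    fix y assume y: "y \<in> points ?sd"
    have uy: "unsubdivide y \<in> points K"
      using continuous_map_unsubdivide y by (auto dest: continuous_map_funspace)
    let ?l = "level_sets (unsubdivide y)"
    \<comment> \<open>Otherwise some \<open>v\<close> in \<open>s - u\<close> and \<open>w\<close>
      in \<open>u - s\<close> exist; \<open>v\<close> has the strictly larger coordinate as
      \<open>s\<close> is a superlevel set, against \<open>unsubdivide_le\<close>.\<close>
    have mixed: "s \<subseteq> u \<or> u \<subseteq> s" if "s \<in> ?l" "u \<in> supp y" for s u
      using that unsubdivide_le[OF y, of u] by (force simp: level_sets_def)
    have "?l \<in> ?sd" "supp y \<in> ?sd"
      using level_sets_mem_sd[OF uy] points_supp(1)[OF finite_complex_sd[OF K] y] .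
    then have "?l \<union> supp y \<in> ?sd"
      using mixed unfolding barycentric_subdivision_def by (rule order_complex_Un)
    then show "\<exists>s\<in>?sd. supp ((subdivide K \<circ> unsubdivide) y) \<subseteq> s \<and> supp (id y) \<subseteq> s"
      using supp_subdivide[OF uy] by auto
  qed
qed simp

lemma sd_homotopy_equivalent:
  "geometric_realization (barycentric_subdivision K) homotopy_equivalent_space geometric_realization K"
  unfolding homotopy_equivalent_space_def
  using continuous_map_subdivide continuous_map_unsubdivide unsubdivide_subdivide
    subdivide_unsubdivide by blast

end

section \<open>Homotopies between simplicial maps\<close>

text \<open>This is the classical contiguity of vertex maps: the face in the hypothesis for
  \<open>supp x\<close> contains the supports of both images of \<open>x\<close>.\<close>

lemma homotopic_simplicial_maps:
  assumes K: "finite_complex K" and L: "finite_complex L"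
    and face: "\<And>s. s \<in> K \<Longrightarrow> \<phi> ` s \<union> \<psi> ` s \<in> L"
  shows "homotopic_with (\<lambda>_. True) (geometric_realization K) (geometric_realization L)
    (simplicial_map K L \<phi>) (simplicial_map K L \<psi>)"
proof -
  have \<phi>: "\<phi> ` s \<in> L" and \<psi>: "\<psi> ` s \<in> L" if "s \<in> K" "s \<noteq> {}" for s
    using finite_complex_subset[OF L face[OF that(1)]] by auto
  show ?thesis
  proof (rule homotopic_if_contiguous[OF L])
    show "continuous_map (geometric_realization K) (geometric_realization L) (simplicial_map K L \<phi>)"
      by (rule continuous_map_simplicial_map[OF K L \<phi>])
    show "continuous_map (geometric_realization K) (geometric_realization L) (simplicial_map K L \<psi>)"
      by (rule continuous_map_simplicial_map[OF K L \<psi>])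
    show "contiguous (geometric_realization K) L (simplicial_map K L \<phi>) (simplicial_map K L \<psi>)"
      unfolding contiguous_def
    proof
      fix x assume x: "x \<in> points K"
      show "\<exists>s\<in>L. supp (simplicial_map K L \<phi> x) \<subseteq> s \<and> supp (simplicial_map K L \<psi> x) \<subseteq> s"
        using face[OF points_supp(1)[OF K x]] supp_simplicial_map[OF K L \<phi> x]
          supp_simplicial_map[OF K L \<psi> x] by auto
    qed
  qed
qed

text \<open>Comparable antitone maps are joined by switching from \<open>\<alpha>\<close> to \<open>\<beta>\<close> one dimension at a time:
  a chain of faces contains at most one face of each dimension, so that consecutive maps in this
  sequence are contiguous.\<close>

lemma homotopic_antitone_maps:
  assumes K: "finite_complex K" and P: "finite P" and le: "reflp le" "transp le"
    and \<alpha>: "\<And>s. s \<in> K - {{}} \<Longrightarrow> \<alpha> s \<in> P" and \<beta>: "\<And>s. s \<in> K - {{}} \<Longrightarrow> \<beta> s \<in> P"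
    and \<alpha>_anti: "\<And>s t. t \<in> K - {{}} \<Longrightarrow> s \<noteq> {} \<Longrightarrow> s \<subseteq> t \<Longrightarrow> le (\<alpha> t) (\<alpha> s)"
    and \<beta>_anti: "\<And>s t. t \<in> K - {{}} \<Longrightarrow> s \<noteq> {} \<Longrightarrow> s \<subseteq> t \<Longrightarrow> le (\<beta> t) (\<beta> s)"
    and \<alpha>_le_\<beta>: "\<And>s. s \<in> K - {{}} \<Longrightarrow> le (\<alpha> s) (\<beta> s)"
  shows "homotopic_with (\<lambda>_. True) (geometric_realization (barycentric_subdivision K))
    (geometric_realization (order_complex P le))
    (simplicial_map (barycentric_subdivision K) (order_complex P le) \<alpha>)
    (simplicial_map (barycentric_subdivision K) (order_complex P le) \<beta>)"
proof -
  let ?sd = "barycentric_subdivision K" and ?P = "order_complex P le"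
  \<comment> \<open>Small faces switch to \<open>\<beta>\<close> first. For \<open>s\<close>
    properly inside \<open>t\<close> this mixes \<open>\<alpha> t\<close> with
    \<open>\<beta> s\<close>, which are comparable through \<open>\<alpha> s\<close>; the opposite
    mixture \<open>\<beta> t\<close>, \<open>\<alpha> s\<close> need not be comparable.\<close>
  define \<gamma> where "\<gamma> j s = (if card s \<le> j then \<beta> s else \<alpha> s)" for j :: nat and s
  note sdK = finite_complex_sd[OF K] and PL = finite_complex_order_complex[OF P, of le]
  have fin: "finite s" if "s \<in> K - {{}}" for s
    using K that by (simp add: finite_complex_def)
  have cmp: "le (\<gamma> i' t) (\<gamma> i s) \<or> le (\<gamma> i s) (\<gamma> i' t)"
    if st: "s \<in> K - {{}}" "t \<in> K - {{}}" "s \<subseteq> t" "i \<in> {j, Suc j}" "i' \<in> {j, Suc j}" for s t i i' j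
  proof (cases "s = t")
    case True
    then show ?thesis
      using \<alpha>_le_\<beta>[OF st(1)] reflpD[OF le(1)] by (auto simp: \<gamma>_def)
  next
    case False
    then have less: "card s < card t"
      using st fin[of t] by (intro psubset_card_mono) auto
    have "le (\<alpha> t) (\<alpha> s)" "le (\<beta> t) (\<beta> s)" "le (\<alpha> t) (\<beta> s)"
      using \<alpha>_anti[of t s] \<beta>_anti[of t s] \<alpha>_le_\<beta>[of s] st transpD[OF le(2)] by blast+
    \<comment> \<open>The pair \<open>\<beta> t\<close>, \<open>\<alpha> s\<close> would require
      \<open>card t \<le> Suc j\<close> and \<open>j < card s\<close>, which is impossible when
      \<open>card s < card t\<close>.\<close>
    then show ?thesis
      using less st(4,5) by (auto simp: \<gamma>_def)
  qed
  have face2: "\<gamma> j ` c \<union> \<gamma> (Suc j) ` c \<in> ?P" if "c \<in> ?sd" for j c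
  proof -
    have c: "c \<subseteq> K - {{}}" "finite c" "Complete_Partial_Order.chain (\<subseteq>) c"
      using that by (auto simp: barycentric_subdivision_def order_complex_def)
    have mem: "\<exists>i s. p = \<gamma> i s \<and> i \<in> {j, Suc j} \<and> s \<in> c" if "p \<in> \<gamma> j ` c \<union> \<gamma> (Suc j) ` c" for p
      using that by auto
    have "le p q \<or> le q p" if pq: "p \<in> \<gamma> j ` c \<union> \<gamma> (Suc j) ` c" "q \<in> \<gamma> j ` c \<union> \<gamma> (Suc j) ` c" for p q
    proof -
      obtain i s where "p = \<gamma> i s" "i \<in> {j, Suc j}" "s \<in> c"
        using mem[OF pq(1)] by blast
      moreover obtain i' t where "q = \<gamma> i' t" "i' \<in> {j, Suc j}" "t \<in> c"
        using mem[OF pq(2)] by blast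
      moreover have "s \<in> K - {{}}" "t \<in> K - {{}}"
        using c(1) \<open>s \<in> c\<close> \<open>t \<in> c\<close> by blast+
      ultimately show ?thesis
        using cmp[of s t i j i'] cmp[of t s i' j i] chainD[OF c(3), of s t] by metis
    qed
    then have "Complete_Partial_Order.chain le (\<gamma> j ` c \<union> \<gamma> (Suc j) ` c)"
      by (rule chainI)
    moreover have "\<gamma> i s \<in> P" if "s \<in> c" for i s
      using that c(1) \<alpha>[of s] \<beta>[of s] by (auto simp: \<gamma>_def)
    ultimately show ?thesis
      using c(2) unfolding order_complex_def by blast
  qed
  let ?h = "homotopic_with (\<lambda>_. True) (geometric_realization ?sd) (geometric_realization ?P)"
  have step: "?h (simplicial_map ?sd ?P (\<gamma> j)) (simplicial_map ?sd ?P (\<gamma> (Suc j)))" for j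
    by (rule homotopic_simplicial_maps[OF sdK PL face2])
  have all: "?h (simplicial_map ?sd ?P (\<gamma> 0)) (simplicial_map ?sd ?P (\<gamma> j))" for j
  proof (induction j)
    case 0
    \<comment> \<open>Reflexivity needs continuity of the first map, which a homotopy starting at it
      supplies.\<close>
    show ?case
      using step[of 0] homotopic_with_imp_continuous_maps by (simp, blast)
  next
    case (Suc j)
    then show ?case
      using step homotopic_with_trans by blast
  qed
  \<comment> \<open>The vertex maps may differ off the nonempty faces, for instance at the empty
    set, so agreement on faces is turned into a homotopy rather than an equation.\<close>
  have ends: "?h (simplicial_map ?sd ?P \<phi>) (simplicial_map ?sd ?P (\<gamma> j))"
    if eq: "\<And>s. s \<in> K - {{}} \<Longrightarrow> \<phi> s = \<gamma> j s" for \<phi> j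
  proof (rule homotopic_simplicial_maps[OF sdK PL])
    fix c assume c: "c \<in> ?sd"
    have "\<phi> ` c = \<gamma> j ` c"
      using c eq by (intro image_cong) (auto simp: barycentric_subdivision_def order_complex_def)
    then show "\<phi> ` c \<union> \<gamma> j ` c \<in> ?P"
      using finite_complex_subset[OF PL face2[OF c, of j], of "\<gamma> j ` c"] by simp
  qed
  \<comment> \<open>No face has more than \<open>N\<close> vertices, so \<open>\<gamma> N\<close>
    agrees with \<open>\<beta>\<close> on faces; nonempty faces have positive cardinality, so
    \<open>\<gamma> 0\<close> agrees with \<open>\<alpha>\<close>.\<close>
  define N where "N = card (\<Union>K)"
  have N: "card s \<le> N" if "s \<in> K" for s
    unfolding N_def using finite_complex_vertices[OF K] that by (intro card_mono) auto
  have "?h (simplicial_map ?sd ?P \<alpha>) (simplicial_map ?sd ?P (\<gamma> 0))"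
    using fin by (intro ends) (auto simp: \<gamma>_def)
  moreover have "?h (simplicial_map ?sd ?P \<beta>) (simplicial_map ?sd ?P (\<gamma> N))"
    using N by (intro ends) (auto simp: \<gamma>_def)
  ultimately show ?thesis
    using all[of N] homotopic_with_trans homotopic_with_symD by blast
qed

section \<open>Comparing a subdivision with an order complex\<close>

lemma chain_least:
  assumes "finite c" "c \<noteq> {}" "Complete_Partial_Order.chain le c" "reflp le" "transp le"
  shows "\<exists>p\<in>c. \<forall>q\<in>c. le p q"
  using assms(1-3)
proof (induction c rule: finite_ne_induct)
  case (singleton p)
  then show ?case
    using reflpD[OF assms(4)] by simp
next
  case (insert x c)
  then obtain p where p: "p \<in> c" "\<forall>q\<in>c. le p q"
    using chain_subset[of le "insert x c" c] by blast
  then have "le x p \<or> le p x"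
    using insert.prems by (simp add: chain_def)
  then show ?case
    using p transpD[OF assms(5)] reflpD[OF assms(4)] by blast
qed

text \<open>The homotopy argument separated from the combinatorics of partitions: \<open>af\<close>
  yields a left homotopy inverse of the map induced by \<open>f\<close>, and \<open>fa\<close> a
  right one.\<close>

lemma sd_homotopy_equivalent_order_complex:
  fixes K :: "'a set set" and P :: "'b set"
  assumes K: "finite_complex K" and P: "finite P" and le: "reflp le" "transp le"
    and f: "\<And>s. s \<in> K - {{}} \<Longrightarrow> f s \<in> P"
    and f_anti: "\<And>s t. t \<in> K - {{}} \<Longrightarrow> s \<noteq> {} \<Longrightarrow> s \<subseteq> t \<Longrightarrow> le (f t) (f s)"
    and a: "\<And>c. c \<in> order_complex P le \<Longrightarrow> c \<noteq> {} \<Longrightarrow> a ` c \<in> K"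
    and af: "\<And>s. s \<in> K - {{}} \<Longrightarrow> a (f s) \<in> s"
    and fa: "\<And>c p. c \<in> order_complex P le \<Longrightarrow> p \<in> c \<Longrightarrow> \<forall>q\<in>c. le p q \<Longrightarrow> le p (f (a ` c))"
  shows "geometric_realization (barycentric_subdivision K) homotopy_equivalent_space
         geometric_realization (order_complex P le)"
proof -
  let ?D = "order_complex P le"
  let ?SK = "barycentric_subdivision K" and ?SD = "barycentric_subdivision ?D"
  note D = finite_complex_order_complex[OF P, of le]
  note SK = finite_complex_sd[OF K] and SD = finite_complex_sd[OF D]
  define F where "F = simplicial_map ?SK ?D f"
  define G where "G = simplicial_map ?D K a"
  define A where "A = simplicial_map ?SD ?SK ((`) a)"
  define B where "B = simplicial_map ?SD ?D (\<lambda>c. f (a ` c))"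
  \<comment> \<open>The relation is assumed only reflexive and transitive, so a chain may have
    several least elements and one is chosen.\<close>
  define least where "least c = (SOME p. p \<in> c \<and> (\<forall>q\<in>c. le p q))" for c
  define M where "M = simplicial_map ?SD ?D least"
  have ac: "a ` c \<in> K - {{}}" if "c \<in> ?D - {{}}" for c
    using a that by auto
  have least: "least c \<in> c" "\<forall>q\<in>c. le (least c) q" if c: "c \<in> ?D - {{}}" for c
  proof -
    have "\<exists>p\<in>c. \<forall>q\<in>c. le p q"
      using c by (intro chain_least le) (auto simp: order_complex_def)
    then have "\<exists>p. p \<in> c \<and> (\<forall>q\<in>c. le p q)"
      by blast
    then have "least c \<in> c \<and> (\<forall>q\<in>c. le (least c) q)"
      unfolding least_def by (rule someI_ex)
    then show "least c \<in> c" "\<forall>q\<in>c. le (least c) q"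
      by auto
  qed
  have sub_P: "c \<subseteq> P" if "c \<in> ?D" for c
    using that by (simp add: order_complex_def)
  have F_face: "f ` c \<in> ?D" if "c \<in> ?SK" for c
    using that f f_anti unfolding barycentric_subdivision_def
    by (intro order_complex_image[of c "K - {{}}" "(\<subseteq>)"]) auto
  have A_face: "((`) a) ` c \<in> ?SK" if "c \<in> ?SD" for c
    using that ac unfolding barycentric_subdivision_def
    by (intro order_complex_image[of c "?D - {{}}" "(\<subseteq>)"]) auto
  have B_face: "(\<lambda>c. f (a ` c)) ` d \<in> ?D" if "d \<in> ?SD" for d
    using F_face[OF A_face[OF that]] by (simp add: image_image)
  have M_face: "least ` d \<in> ?D" if d: "d \<in> ?SD" for d
  proof (cases "d = {}")
    case False
    \<comment> \<open>All chains in \<open>d\<close> lie inside the largest one, so their least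
      elements form a subset of a chain.\<close>
    have "least ` d \<subseteq> \<Union>d"
      using d least(1) by (auto simp: barycentric_subdivision_def order_complex_def)
    then show ?thesis
      using Union_sd_face(2)[OF d False] finite_complex_subset[OF D] by blast
  qed (simp add: order_complex_def chain_def)
  have cF: "continuous_map (geometric_realization ?SK) (geometric_realization ?D) F"
    unfolding F_def by (rule continuous_map_simplicial_map[OF SK D F_face])
  have cG: "continuous_map (geometric_realization ?D) (geometric_realization K) G"
    unfolding G_def by (rule continuous_map_simplicial_map[OF D K a])
  have cA: "continuous_map (geometric_realization ?SD) (geometric_realization ?SK) A"
    unfolding A_def by (rule continuous_map_simplicial_map[OF SD SK A_face])
  have cB: "continuous_map (geometric_realization ?SD) (geometric_realization ?D) B"
    unfolding B_def by (rule continuous_map_simplicial_map[OF SD D B_face])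
  have cM: "continuous_map (geometric_realization ?SD) (geometric_realization ?D) M"
    unfolding M_def by (rule continuous_map_simplicial_map[OF SD D M_face])
  have sF: "supp (F x) = f ` supp x" if "x \<in> points ?SK" for x
    unfolding F_def by (rule supp_simplicial_map[OF SK D F_face that])
  have sG: "supp (G x) = a ` supp x" if "x \<in> points ?D" for x
    unfolding G_def by (rule supp_simplicial_map[OF D K a that])
  have sA: "supp (A x) = (`) a ` supp x" if "x \<in> points ?SD" for x
    unfolding A_def by (rule supp_simplicial_map[OF SD SK A_face that])
  have sB: "supp (B x) = (\<lambda>c. f (a ` c)) ` supp x" if "x \<in> points ?SD" for x
    unfolding B_def by (rule supp_simplicial_map[OF SD D B_face that])
  have sM: "supp (M x) = least ` supp x" if "x \<in> points ?SD" for x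
    unfolding M_def by (rule supp_simplicial_map[OF SD D M_face that])
  note cSK = continuous_map_subdivide[OF K] and cUK = continuous_map_unsubdivide[OF K]
    and cSD = continuous_map_subdivide[OF D]
  let ?hom = "\<lambda>K L. homotopic_with (\<lambda>_. True) (geometric_realization K) (geometric_realization L)"

  have "?hom ?SK K (G \<circ> F) (unsubdivide K)"
  proof (rule homotopic_if_contiguous[OF K continuous_map_compose[OF cF cG] cUK])
    show "contiguous (geometric_realization ?SK) K (G \<circ> F) (unsubdivide K)"
      unfolding contiguous_def
    proof
      fix x assume x: "x \<in> points ?SK"
      note px = points_supp(1,2)[OF SK x]
      have "F x \<in> points ?D"
        using cF x by (auto dest: continuous_map_funspace)
      then have "supp (G (F x)) = (\<lambda>s. a (f s)) ` supp x"
        using sG sF[OF x] by (simp add: image_image)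
      moreover have "a (f s) \<in> \<Union>(supp x)" if "s \<in> supp x" for s
      proof -
        have "s \<in> K - {{}}"
          using px(1) that by (auto simp: barycentric_subdivision_def order_complex_def)
        then show ?thesis
          using af that by blast
      qed
      ultimately have "supp (G (F x)) \<subseteq> \<Union>(supp x)"
        by auto
      then show "\<exists>s\<in>K. supp ((G \<circ> F) x) \<subseteq> s \<and> supp (unsubdivide K x) \<subseteq> s"
        using supp_unsubdivide[OF K x] Union_sd_face(2)[OF px] by auto
    qed
  qed
  \<comment> \<open>Subdividing moves the homotopy from \<open>K\<close> into its subdivision, where
    the right-hand map is homotopic to the identity.\<close>
  then have "?hom ?SK ?SK (subdivide K \<circ> (G \<circ> F)) (subdivide K \<circ> unsubdivide K)"
    using cSK by (rule homotopic_with_compose_continuous_map_left) simp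
  then have left: "?hom ?SK ?SK ((subdivide K \<circ> G) \<circ> F) id"
    using subdivide_unsubdivide[OF K] homotopic_with_trans unfolding comp_assoc by blast

  \<comment> \<open>Both maps have the same support at every point, which is enough for a
    straight-line homotopy.\<close>
  have "?hom ?SD ?D (F \<circ> A) B"
  proof (rule homotopic_if_contiguous[OF D continuous_map_compose[OF cA cF] cB])
    show "contiguous (geometric_realization ?SD) ?D (F \<circ> A) B"
      unfolding contiguous_def
    proof
      fix x assume x: "x \<in> points ?SD"
      have "A x \<in> points ?SK"
        using cA x by (auto dest: continuous_map_funspace)
      then have "supp (F (A x)) = supp (B x)"
        using sF sA[OF x] sB[OF x] by (simp add: image_image)
      then show "\<exists>s\<in>?D. supp ((F \<circ> A) x) \<subseteq> s \<and> supp (B x) \<subseteq> s"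
        using sB[OF x] B_face[OF points_supp(1)[OF SD x]] by auto
    qed
  qed
  \<comment> \<open>Enlarging a chain can only lower its least element, and it enlarges the image
    under \<open>a\<close>, on which \<open>f\<close> reverses inclusion. So both vertex maps are
    antitone, and \<open>fa\<close> compares them.\<close>
  moreover have "?hom ?SD ?D M B"
    unfolding M_def B_def
  proof (rule homotopic_antitone_maps[OF D P le])
    fix s assume s: "s \<in> ?D - {{}}"
    show "least s \<in> P" "f (a ` s) \<in> P"
      using least(1)[OF s] sub_P s f[OF ac[OF s]] by auto
    show "le (least s) (f (a ` s))"
      using fa least[OF s] s by simp
  next
    fix s t assume st: "t \<in> ?D - {{}}" "s \<noteq> {}" "s \<subseteq> t"
    then have "s \<in> ?D - {{}}"
      using finite_complex_subset[OF D, of t s] by simp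
    then show "le (least t) (least s)"
      using least(2)[OF st(1)] least(1) st(3) by blast
    show "le (f (a ` t)) (f (a ` s))"
      using st by (intro f_anti ac) auto
  qed
  ultimately have "?hom ?SD ?D (F \<circ> A) M"
    using homotopic_with_trans homotopic_with_symD by blast
  then have "?hom ?D ?D ((F \<circ> A) \<circ> subdivide ?D) (M \<circ> subdivide ?D)"
    using cSD by (rule homotopic_with_compose_continuous_map_right) simp
  \<comment> \<open>The chosen element of each superlevel set lies in that set, hence in
    \<open>supp x\<close>.\<close>
  moreover have "?hom ?D ?D (M \<circ> subdivide ?D) id"
  proof (rule homotopic_if_contiguous[OF D continuous_map_compose[OF cSD cM]])
    show "contiguous (geometric_realization ?D) ?D (M \<circ> subdivide ?D) id"
      unfolding contiguous_def
    proof
      fix x assume x: "x \<in> points ?D"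
      have "subdivide ?D x \<in> points ?SD"
        using cSD x by (auto dest: continuous_map_funspace)
      then have "supp (M (subdivide ?D x)) = least ` level_sets x"
        by (simp only: sM supp_subdivide[OF D x])
      moreover have "least s \<in> supp x" if "s \<in> level_sets x" for s
      proof -
        have "s \<in> ?D - {{}}"
          using level_sets_subset[OF D x] that by blast
        then have "least s \<in> s"
          by (rule least(1))
        then show ?thesis
          using that by (auto simp: level_sets_def)
      qed
      ultimately have "supp (M (subdivide ?D x)) \<subseteq> supp x"
        by auto
      then show "\<exists>s\<in>?D. supp ((M \<circ> subdivide ?D) x) \<subseteq> s \<and> supp (id x) \<subseteq> s"
        using points_supp(1)[OF D x] by auto
    qed
  qed simp
  ultimately have right: "?hom ?D ?D (F \<circ> (A \<circ> subdivide ?D)) id"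
    using homotopic_with_trans unfolding comp_assoc by blast
  show ?thesis
    by (rule homotopy_equivalence_if_inverses[OF cF continuous_map_compose[OF cG cSK]
          continuous_map_compose[OF cSD cA] left right])
qed

section \<open>Ordered set partitions as chains of sets\<close>

lemma pointed_le_iff:
  "pointed_le (Bs, Z) (Bs', Z') \<longleftrightarrow> (\<forall>B\<in>Bs. \<exists>B'\<in>insert Z' Bs'. B \<subseteq> B') \<and> Z \<subseteq> Z'"
  by (simp add: pointed_le_def)

lemma reflp_pointed_le: "reflp pointed_le"
  unfolding reflp_def pointed_le_def by auto

lemma transp_pointed_le: "transp pointed_le"
proof (rule transpI)
  fix p q r assume pq: "pointed_le p q" and qr: "pointed_le q r"
  obtain Bs Z Bs' Z' Bs'' Z'' where eq: "p = (Bs, Z)" "q = (Bs', Z')" "r = (Bs'', Z'')"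
    by (metis prod.exhaust)
  have "\<exists>B''\<in>insert Z'' Bs''. B \<subseteq> B''" if B: "B \<in> Bs" for B
  proof -
    obtain B' where B': "B' \<in> insert Z' Bs'" "B \<subseteq> B'"
      using pq B unfolding eq pointed_le_iff by blast
    obtain B'' where "B'' \<in> insert Z'' Bs''" "B' \<subseteq> B''"
      using qr B'(1) unfolding eq pointed_le_iff by blast
    then show ?thesis
      using B'(2) by (blast intro: order_trans)
  qed
  moreover have "Z \<subseteq> Z''"
    using pq qr by (auto simp: eq pointed_le_def)
  ultimately show "pointed_le p r"
    unfolding eq pointed_le_iff by blast
qed

lemma finite_pointed_partitions: "finite (pointed_partitions n)"
proof (rule finite_subset)
  show "pointed_partitions n \<subseteq> Pow (Pow {1..n}) \<times> Pow {1..n}"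
    by (auto simp: pointed_partitions_def partition_on_def)
qed simp

lemma pointed_filter_upward:
  "q \<in> pointed_filter n lam m \<Longrightarrow> pointed_le q r \<Longrightarrow> r \<in> pointed_partitions n \<Longrightarrow>
   r \<in> pointed_filter n lam m"
  unfolding pointed_filter_def using transpD[OF transp_pointed_le] by blast

section \<open>Pointed partitions cut out by families of sets\<close>

text \<open>The atom of the family \<open>W\<close> around \<open>x\<close>. For a finite chain of
  nonempty sets the atoms inside the union are the first set and the differences of consecutive
  sets.\<close>

definition block_of :: "nat set set \<Rightarrow> nat \<Rightarrow> nat set" where
  "block_of W x = {y\<in>\<Union>W. \<forall>A\<in>W. x \<in> A \<longleftrightarrow> y \<in> A}"

definition blocks :: "nat set set \<Rightarrow> nat set set" where
  "blocks W = block_of W ` \<Union>W"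

lemma block_of_in_blocks: "x \<in> \<Union>W \<Longrightarrow> block_of W x \<in> blocks W"
  unfolding blocks_def by (rule imageI)

text \<open>Points in no member of \<open>W\<close> form the pointed block; in particular the empty
  family gives the top.\<close>

definition cut_partition :: "nat \<Rightarrow> nat set set \<Rightarrow> pointed_partition" where
  "cut_partition n W = (blocks W, {1..n} - \<Union>W)"

lemma cut_partition_mem:
  assumes "W \<subseteq> Pow {1..n}"
  shows "cut_partition n W \<in> pointed_partitions n"
proof -
  have "partition_on (\<Union>W) (blocks W)"
    by (rule partition_onI) (auto simp: blocks_def block_of_def disjnt_def)
  moreover have "{1..n} - ({1..n} - \<Union>W) = \<Union>W"
    using assms by auto
  ultimately show ?thesis
    by (auto simp: pointed_partitions_def cut_partition_def)
qed

text \<open>Fewer sets separate fewer points, so atoms are merged. An atom with a point outside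
  \<open>\<Union>W'\<close> lies outside it entirely and is absorbed by the pointed block.\<close>

lemma cut_partition_antimono:
  assumes "W' \<subseteq> W" "W \<subseteq> Pow {1..n}"
  shows "pointed_le (cut_partition n W) (cut_partition n W')"
proof -
  have "\<exists>B'\<in>insert ({1..n} - \<Union>W') (blocks W'). B \<subseteq> B'" if B: "B \<in> blocks W" for B
  proof -
    obtain x where x: "x \<in> \<Union>W" "B = block_of W x"
      using B unfolding blocks_def by blast
    show ?thesis
    proof (cases "x \<in> \<Union>W'")
      case True
      then have "B \<subseteq> block_of W' x"
        using x assms(1) unfolding block_of_def by blast
      then show ?thesis
        using block_of_in_blocks[OF True] by (intro bexI[where x = "block_of W' x"] insertI2)
    next
      case False
      have "B \<subseteq> {1..n} - \<Union>W'"
      proof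
        fix y assume "y \<in> B"
        then have "y \<in> \<Union>W" "\<And>A. A \<in> W \<Longrightarrow> x \<in> A \<longleftrightarrow> y \<in> A"
          by (auto simp: x(2) block_of_def)
        then show "y \<in> {1..n} - \<Union>W'"
          using False assms by blast
      qed
      then show ?thesis by (intro bexI[where x = "{1..n} - \<Union>W'"] insertI1)
    qed
  qed
  then show ?thesis
    using assms(1) by (auto simp: pointed_le_def cut_partition_def)
qed

text \<open>Every block of \<open>p\<close> lies inside or outside each set \<open>{1..n} - Z\<close> with \<open>Z\<close> the pointed block
  of a coarser partition.\<close>

lemma pointed_le_cut_partition:
  assumes c: "c \<subseteq> pointed_partitions n" and p: "p \<in> pointed_partitions n" "\<forall>q\<in>c. pointed_le p q"
  shows "pointed_le p (cut_partition n ((\<lambda>q. {1..n} - snd q) ` c))"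
proof -
  define W where "W = (\<lambda>q. {1..n} - snd q) ` c"
  obtain Bs Z where pZ: "p = (Bs, Z)"
    by (cases p)
  then have Z: "Z \<subseteq> {1..n}" and Bs: "\<Union>Bs = {1..n} - Z" "{} \<notin> Bs"
    using p(1) by (auto simp: pointed_partitions_def partition_on_def)
  have "\<exists>B'\<in>insert ({1..n} - \<Union>W) (blocks W). B \<subseteq> B'" if B: "B \<in> Bs" for B
  proof -
    have split: "B \<subseteq> A \<or> B \<inter> A = {}" if "A \<in> W" for A
    proof -
      obtain q where q: "q \<in> c" "A = {1..n} - snd q"
        using \<open>A \<in> W\<close> by (auto simp: W_def)
      obtain Bs' Z' where q': "q = (Bs', Z')"
        by (cases q)
      have "\<Union>Bs' = {1..n} - Z'"
        using q(1) c q' by (auto simp: pointed_partitions_def partition_on_def)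
      moreover have "\<exists>B'\<in>insert Z' Bs'. B \<subseteq> B'"
        using bspec[OF p(2) q(1)] B unfolding pZ q' pointed_le_iff by blast
      ultimately show ?thesis
        using q(2) q' by auto
    qed
    obtain x where x: "x \<in> B"
      using B Bs by fastforce
    have B_sub: "B \<subseteq> {1..n}"
      using B Bs by auto
    show ?thesis
    proof (cases "x \<in> \<Union>W")
      case True
      have "x \<in> A \<longleftrightarrow> y \<in> A" if "y \<in> B" "A \<in> W" for y A
        using split[OF that(2)] x that(1) by blast
      then have "B \<subseteq> block_of W x"
        using True by (auto simp: block_of_def)
      then show ?thesis
        using block_of_in_blocks[OF True] by (intro bexI[where x = "block_of W x"] insertI2)
    next
      case False
      then have "B \<subseteq> {1..n} - \<Union>W"
        using split x B_sub by fast
      then show ?thesis by (intro bexI[where x = "{1..n} - \<Union>W"] insertI1)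
    qed
  qed
  moreover have "Z \<subseteq> {1..n} - \<Union>W"
    using p(2) Z by (force simp: W_def pZ pointed_le_def)
  ultimately show ?thesis
    unfolding W_def[symmetric]
    unfolding pZ cut_partition_def pointed_le_iff by blast
qed

section \<open>Prefixes of ordered set partitions\<close>

text \<open>A set \<open>A\<close> encodes the vertex with first block \<open>A\<close>, and
  \<open>hd\<close> recovers it; faces can thus be handled as chains of sets.\<close>

definition cut :: "nat \<Rightarrow> nat set \<Rightarrow> nat set list" where
  "cut n A = [A, {1..n} - A]"

text \<open>The full list is excluded, but if the last block is empty, the whole ground set is still
  a prefix once there are two blocks; it encodes the vertex with empty second block.\<close>

definition prefixes :: "nat set list \<Rightarrow> nat set set" where
  "prefixes D = {\<Union>(set (take i D)) |i. 0 < i \<and> i < length D}"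

text \<open>The ground set is a parameter because the construction of an ordered partition from a
  chain recurses into smaller sets.\<close>

definition ordered_partition_of :: "nat set \<Rightarrow> nat set list \<Rightarrow> bool" where
  "ordered_partition_of U D \<longleftrightarrow> D \<noteq> [] \<and> disjoint_family_on (\<lambda>i. D ! i) {..<length D} \<and>
     \<Union>(set D) = U \<and> {} \<notin> set (butlast D)"

lemma ordered_partitions_iff: "D \<in> ordered_partitions n \<longleftrightarrow> ordered_partition_of {1..n} D"
  by (simp add: ordered_partitions_def ordered_partition_of_def)

lemma mem_set_butlast_iff: "B \<in> set (butlast D) \<longleftrightarrow> (\<exists>j. Suc j < length D \<and> B = D ! j)"
proof -
  have "j < length (butlast D) \<longleftrightarrow> Suc j < length D" for j
    by auto
  then show ?thesis
    unfolding in_set_conv_nth using nth_butlast by metis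
qed

context
  fixes U :: "nat set" and D :: "nat set list"
  assumes D: "ordered_partition_of U D"
begin

lemma mem_Union_take_iff:
  assumes "x \<in> D ! j" "j < length D"
  shows "x \<in> \<Union>(set (take i D)) \<longleftrightarrow> j < i"
proof
  assume "x \<in> \<Union>(set (take i D))"
  then obtain k where k: "k < i" "k < length D" "x \<in> D ! k"
    by (auto simp: in_set_conv_nth)
  then have "k = j"
    using assms D unfolding ordered_partition_of_def disjoint_family_on_def by blast
  then show "j < i"
    using k by simp
next
  assume "j < i"
  then show "x \<in> \<Union>(set (take i D))"
    using assms by (auto simp: in_set_conv_nth intro!: bexI[of _ "D ! j"] exI[of _ j])
qed

lemma ordered_partition_block: "j < length D \<Longrightarrow> D ! j \<subseteq> U"
  using D by (auto simp: ordered_partition_of_def)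

lemma Union_drop_eq: "\<Union>(set (drop i D)) = U - \<Union>(set (take i D))"
proof (intro set_eqI iffI)
  fix x assume "x \<in> \<Union>(set (drop i D))"
  then obtain j where j: "i \<le> j" "j < length D" "x \<in> D ! j"
    by (auto simp: in_set_conv_nth) (metis add.commute le_add1 less_diff_conv)
  then show "x \<in> U - \<Union>(set (take i D))"
    using mem_Union_take_iff[of x j i] ordered_partition_block by auto
next
  fix x assume x: "x \<in> U - \<Union>(set (take i D))"
  then have "x \<in> \<Union>(set (take i D @ drop i D))"
    using D by (simp add: ordered_partition_of_def)
  then show "x \<in> \<Union>(set (drop i D))"
    using x by (simp only: set_append Union_Un_distrib) blast
qed

lemma prefixes_nonempty: "{} \<notin> prefixes D"
proof
  assume "{} \<in> prefixes D"
  then obtain i where i: "{} = \<Union>(set (take i D))" "0 < i" "i < length D"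
    unfolding prefixes_def by (elim CollectE exE conjE) (rule that)
  have "x \<notin> D ! 0" for x
  proof
    assume "x \<in> D ! 0"
    then have "x \<in> \<Union>(set (take i D))"
      using i(2,3) by (intro mem_Union_take_iff[THEN iffD2, of x 0 i]) linarith+
    then show False
      using i(1) by simp
  qed
  then have "D ! 0 = {}"
    by auto
  \<comment> \<open>A prefix exists only if there are at least two blocks, so the first block is not
    the possibly empty last one.\<close>
  moreover have "D ! 0 \<in> set (butlast D)"
    using i by (auto simp: in_set_conv_nth nth_butlast intro!: exI[of _ 0])
  ultimately show False
    using D by (simp add: ordered_partition_of_def)
qed

lemma Union_prefixes: "\<Union>(prefixes D) = \<Union>(set (butlast D))"
proof -
  have "\<Union>(set (take i D)) \<subseteq> \<Union>(set (butlast D))" if "i < length D" for i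
    using that by (intro Union_mono) (simp add: butlast_conv_take set_take_subset_set_take)
  moreover have "\<Union>(set (butlast D)) \<subseteq> \<Union>(prefixes D)"
  \<comment> \<open>A single block has no prefix, and then both sides are empty; otherwise dropping
    the last block gives the largest prefix.\<close>
  proof (cases "length D = 1")
    case True
    then show ?thesis by (simp add: butlast_conv_take)
  next
    case False
    then have "\<Union>(set (butlast D)) \<in> prefixes D"
      using D unfolding prefixes_def butlast_conv_take
      by (cases "length D") (auto simp: ordered_partition_of_def)
    then show ?thesis by blast
  qed
  ultimately show ?thesis
    unfolding prefixes_def by blast
qed

lemma prefixes_subset: "prefixes D \<subseteq> Pow U"
  using D by (auto simp: prefixes_def ordered_partition_of_def dest!: in_set_takeD)

lemma chain_prefixes: "Complete_Partial_Order.chain (\<subseteq>) (prefixes D)"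
proof (rule chainI)
  fix A B assume "A \<in> prefixes D" "B \<in> prefixes D"
  then obtain i j where "A = \<Union>(set (take i D))" "B = \<Union>(set (take j D))"
    by (auto simp: prefixes_def)
  then show "A \<subseteq> B \<or> B \<subseteq> A"
    using set_take_subset_set_take[of i j D] set_take_subset_set_take[of j i D]
    by (meson Union_mono nle_le)
qed

lemma blocks_prefixes: "blocks (prefixes D) = set (butlast D)"
proof -
  have cls: "block_of (prefixes D) x = D ! j"
    if j: "Suc j < length D" "x \<in> D ! j" for x j
  proof (intro set_eqI iffI)
    fix y assume "y \<in> block_of (prefixes D) x"
    then have y: "y \<in> \<Union>(prefixes D)" "\<And>i. 0 < i \<Longrightarrow> i < length D \<Longrightarrow>
        x \<in> \<Union>(set (take i D)) \<longleftrightarrow> y \<in> \<Union>(set (take i D))"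
      by (auto simp: prefixes_def block_of_def)
    obtain k where k: "Suc k < length D" "y \<in> D ! k"
      using y(1) unfolding Union_prefixes
      by (auto simp: mem_set_butlast_iff)
    have "j < i \<longleftrightarrow> k < i" if "0 < i" "i < length D" for i
      using y(2)[OF that] mem_Union_take_iff[of x j i] mem_Union_take_iff[of y k i] j k by simp
    \<comment> \<open>The prefixes of lengths \<open>Suc j\<close> and \<open>Suc k\<close> separate
      block \<open>j\<close> from block \<open>k\<close> unless \<open>j = k\<close>; both lengths
      are admissible because neither block is the last.\<close>
    from this[of "Suc j"] this[of "Suc k"] have "j = k"
      using j k by simp
    then show "y \<in> D ! j"
      using k by simp
  next
    fix y assume y: "y \<in> D ! j"
    have "D ! j \<in> set (butlast D)"
      using j by (auto simp: mem_set_butlast_iff)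
    then have "y \<in> \<Union>(set (butlast D))"
      using y by (rule UnionI)
    moreover have "x \<in> A \<longleftrightarrow> y \<in> A" if "A \<in> prefixes D" for A
    proof -
      obtain i where "A = \<Union>(set (take i D))"
        using \<open>A \<in> prefixes D\<close> by (auto simp: prefixes_def)
      then show ?thesis
        using mem_Union_take_iff[of x j i] mem_Union_take_iff[of y j i] y j by simp
    qed
    ultimately show "y \<in> block_of (prefixes D) x"
      unfolding block_of_def Union_prefixes by simp
  qed
  show ?thesis
  proof (intro set_eqI iffI)
    fix B assume "B \<in> blocks (prefixes D)"
    then obtain x where x: "x \<in> \<Union>(set (butlast D))"
        "B = block_of (prefixes D) x"
      unfolding blocks_def by (auto simp: Union_prefixes)
    then obtain j where "Suc j < length D" "x \<in> D ! j"
      by (auto simp: mem_set_butlast_iff)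
    then show "B \<in> set (butlast D)"
      using x(2) cls by (auto simp: mem_set_butlast_iff)
  next
    fix B assume B: "B \<in> set (butlast D)"
    then obtain j where j: "Suc j < length D" "B = D ! j"
      by (auto simp: mem_set_butlast_iff)
    obtain x where x: "x \<in> B"
      using B D by (fastforce simp: ordered_partition_of_def)
    have "B = block_of (prefixes D) x"
      using cls[of j x] j x by simp
    moreover have "x \<in> \<Union>(prefixes D)"
      using x B unfolding Union_prefixes by blast
    ultimately show "B \<in> blocks (prefixes D)"
      using block_of_in_blocks by simp
  qed
qed

lemma last_eq: "last D = U - \<Union>(prefixes D)"
  using D Union_drop_eq[of "length D - 1"] unfolding Union_prefixes butlast_conv_take
  by (simp add: ordered_partition_of_def last_conv_nth Cons_nth_drop_Suc[symmetric])

end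

text \<open>Merging into two blocks means splitting the list into two nonempty runs, and the length
  of the first run is the length of the prefix.\<close>

lemma face_vertices_eq:
  assumes "ordered_partition_of {1..n} D"
  shows "face_vertices D = cut n ` prefixes D"
proof (intro set_eqI iffI)
  fix C assume "C \<in> face_vertices D"
  then obtain Dss where Dss: "length C = 2" "concat Dss = D" "[] \<notin> set Dss"
      "C = map (\<lambda>Ds. \<Union>(set Ds)) Dss"
    by (auto simp: face_vertices_def merges_to_def)
  then obtain X Y where XY: "Dss = [X, Y]"
    by (auto simp: length_Suc_conv numeral_2_eq_2)
  then have "X = take (length X) D" "Y = drop (length X) D" "0 < length X" "length X < length D"
    using Dss by auto
  then show "C \<in> cut n ` prefixes D"
    using Dss(4) XY Union_drop_eq[OF assms, of "length X"]
    by (auto simp: prefixes_def cut_def intro!: image_eqI[of _ _ "\<Union>(set X)"] exI[of _ "length X"])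
next
  fix C assume "C \<in> cut n ` prefixes D"
  then obtain i where i: "0 < i" "i < length D" "C = cut n (\<Union>(set (take i D)))"
    by (auto simp: prefixes_def)
  then have "C = map (\<lambda>Ds. \<Union>(set Ds)) [take i D, drop i D]"
    using Union_drop_eq[OF assms] by (simp add: cut_def)
  moreover have "concat [take i D, drop i D] = D" "[] \<notin> set [take i D, drop i D]"
    using i by auto
  ultimately show "C \<in> face_vertices D"
    unfolding face_vertices_def merges_to_def by (auto intro!: exI[of _ "[take i D, drop i D]"])
qed

text \<open>Induction on the size of the chain: its largest set \<open>A\<close> becomes the ground
  set for the other sets, and \<open>U - A\<close> is appended as last block, possibly
  empty.\<close>

lemma ex_ordered_partition_of_chain:
  assumes "finite W" "W \<subseteq> Pow U - {{}}" "Complete_Partial_Order.chain (\<subseteq>) W"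
  shows "\<exists>D. ordered_partition_of U D \<and> prefixes D = W"
  using assms
proof (induction "card W" arbitrary: W U)
  case 0
  then show ?case
    by (intro exI[of _ "[U]"]) (auto simp: ordered_partition_of_def prefixes_def disjoint_family_on_def)
next
  case (Suc k)
  then have "W \<noteq> {}"
    by auto
  define A where "A = \<Union>W"
  have A: "A \<in> W"
    unfolding A_def using Suc.prems \<open>W \<noteq> {}\<close> by (intro chain_subset_Max) auto
  let ?W = "W - {A}"
  have "k = card ?W"
    using Suc.hyps(2) A Suc.prems(1) by simp
  moreover have "?W \<subseteq> Pow A - {{}}"
    using Suc.prems(2) by (auto simp: A_def)
  moreover have "Complete_Partial_Order.chain (\<subseteq>) ?W"
    using Suc.prems(3) by (rule chain_subset) auto
  ultimately obtain D where D: "ordered_partition_of A D" "prefixes D = ?W"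
    using Suc.hyps(1) Suc.prems(1) by blast
  have nonempty: "D \<noteq> []" and UD: "\<Union>(set D) = A"
    using D(1) by (auto simp: ordered_partition_of_def)
  \<comment> \<open>This block becomes an inner one, where emptiness is forbidden. If it were empty,
    \<open>A\<close> would be a prefix of \<open>D\<close>, although it was removed from the
    chain.\<close>
  have "last D \<noteq> {}"
  proof
    assume last: "last D = {}"
    have "\<Union>(set D) = \<Union>(set (butlast D)) \<union> last D"
      using nonempty by (metis append_butlast_last_id Union_Un_distrib set_append list.simps(15)
          cSup_singleton empty_set)
    then have *: "\<Union>(set (butlast D)) = A"
      using last UD by simp
    moreover have "A \<noteq> {}"
      using A Suc.prems(2) by auto
    ultimately have "length D \<noteq> 1"
      by (auto simp: butlast_conv_take)
    then have "A \<in> prefixes D"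
      using nonempty * unfolding prefixes_def butlast_conv_take
      by (cases "length D") auto
    then show False
      using D(2) by simp
  qed
  moreover have "{} \<notin> set (butlast D)"
    using D(1) by (simp add: ordered_partition_of_def)
  ultimately have "{} \<notin> set D"
    using nonempty by (metis Un_iff append_butlast_last_id empty_set list.simps(15) set_append
        singletonD)
  moreover have "disjoint_family_on (\<lambda>i. (D @ [U - A]) ! i) {..<length (D @ [U - A])}"
  proof -
    have "D ! i \<inter> D ! j = {}" if "i < length D" "j < length D" "i \<noteq> j" for i j
      using D(1) that by (auto simp: ordered_partition_of_def disjoint_family_on_def)
    moreover have "x \<in> A" if "i < length D" "x \<in> D ! i" for i x
      using UD that by auto
    ultimately show ?thesis
      unfolding disjoint_family_on_def by (auto simp: nth_append less_Suc_eq)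
  qed
  moreover have "A \<subseteq> U"
    using A Suc.prems(2) by auto
  ultimately have "ordered_partition_of U (D @ [U - A])"
    using UD by (auto simp: ordered_partition_of_def)
  moreover have "prefixes (D @ [U - A]) = W"
  proof -
    have "prefixes (D @ [U - A]) = {\<Union>(set (take i D)) |i. 0 < i \<and> i \<le> length D}"
      unfolding prefixes_def by (auto simp: less_Suc_eq_le)
    also have "\<dots> = {\<Union>(set (take i D)) |i. i = length D \<or> 0 < i \<and> i < length D}"
      using nonempty by (intro Collect_cong ex_cong1) (auto simp: le_less)
    also have "\<dots> = insert (\<Union>(set (take (length D) D))) (prefixes D)"
      unfolding prefixes_def by blast
    finally show ?thesis
      using D(2) A UD by auto
  qed
  ultimately show ?case by blast
qed

section \<open>Faces of the complex as chains of sets\<close>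

text \<open>Ordered partitions correspond to their chains of prefixes, and forgetting the order of
  the blocks becomes \<open>cut_partition\<close> of that chain.\<close>

lemma Lambda_complex_eq:
  "Lambda_complex n lam m = {cut n ` W |W. W \<subseteq> Pow {1..n} - {{}} \<and>
     Complete_Partial_Order.chain (\<subseteq>) W \<and> cut_partition n W \<in> pointed_filter n lam m}"
proof (intro set_eqI iffI)
  fix s assume "s \<in> Lambda_complex n lam m"
  then obtain D where D: "ordered_partition_of {1..n} D" "s = face_vertices D"
      "(set (butlast D), last D) \<in> pointed_filter n lam m"
    by (auto simp: Lambda_complex_def Lambda_faces_def ordered_partitions_iff)
  then have "cut_partition n (prefixes D) \<in> pointed_filter n lam m"
    by (simp add: cut_partition_def blocks_prefixes last_eq)
  then show "s \<in> {cut n ` W |W. W \<subseteq> Pow {1..n} - {{}} \<and>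
     Complete_Partial_Order.chain (\<subseteq>) W \<and> cut_partition n W \<in> pointed_filter n lam m}"
    using D(2) face_vertices_eq[OF D(1)] prefixes_subset[OF D(1)] prefixes_nonempty[OF D(1)]
      chain_prefixes[OF D(1)] by blast
next
  fix s assume "s \<in> {cut n ` W |W. W \<subseteq> Pow {1..n} - {{}} \<and>
     Complete_Partial_Order.chain (\<subseteq>) W \<and> cut_partition n W \<in> pointed_filter n lam m}"
  then obtain W where W: "s = cut n ` W" "W \<subseteq> Pow {1..n} - {{}}"
      "Complete_Partial_Order.chain (\<subseteq>) W" "cut_partition n W \<in> pointed_filter n lam m"
    by blast
  have "finite W"
    using W(2) by (rule finite_subset) simp
  then obtain D where D: "ordered_partition_of {1..n} D" "prefixes D = W"
    using ex_ordered_partition_of_chain W by blast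
  then have "D \<in> Lambda_faces n lam m"
    using W(4) by (simp add: Lambda_faces_def ordered_partitions_iff cut_partition_def
        last_eq[OF D(1)] flip: blocks_prefixes[OF D(1)])
  then show "s \<in> Lambda_complex n lam m"
    using D(2) W(1) face_vertices_eq[OF D(1)] unfolding Lambda_complex_def by blast
qed

lemma hd_cut_image: "hd ` cut n ` W = W"
  by (simp add: image_image cut_def)

text \<open>Closure under subsets holds because a subchain cuts out a coarser partition and the
  filter is closed upwards.\<close>

lemma finite_complex_Lambda: "finite_complex (Lambda_complex n lam m)"
  unfolding finite_complex_def
proof (intro conjI ballI allI impI)
  have "Lambda_complex n lam m \<subseteq> (`) (cut n) ` Pow (Pow {1..n})"
    unfolding Lambda_complex_eq by blast
  then show "finite (Lambda_complex n lam m)"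
    by (rule finite_subset) simp
next
  fix s assume "s \<in> Lambda_complex n lam m"
  then obtain W where W: "s = cut n ` W" "W \<subseteq> Pow {1..n} - {{}}"
      "Complete_Partial_Order.chain (\<subseteq>) W" "cut_partition n W \<in> pointed_filter n lam m"
    unfolding Lambda_complex_eq by blast
  then show "finite s"
    using finite_subset[OF W(2)] by simp
  fix t assume "t \<subseteq> s"
  then obtain W' where W': "W' \<subseteq> W" "t = cut n ` W'"
    using W(1) by (auto simp: subset_image_iff)
  have "cut_partition n W' \<in> pointed_filter n lam m"
    using W(2) W'(1) by (intro pointed_filter_upward[OF W(4)] cut_partition_antimono cut_partition_mem) auto
  moreover have "W' \<subseteq> Pow {1..n} - {{}}"
    using W'(1) W(2) by (rule order_trans)
  ultimately show "t \<in> Lambda_complex n lam m"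
    unfolding Lambda_complex_eq using W'(2) chain_subset[OF W(3) W'(1)]
    by (intro CollectI exI[of _ W'] conjI)
qed

section \<open>The homotopy type of the filter without its top\<close>

theorem theorem8p6:
  fixes n m :: nat and lam :: "nat multiset"
  assumes "pointed_knapsack_partition n lam m"
  shows "geometric_realization (order_complex (pointed_filter n lam m - {pointed_top n}) pointed_le)
           homotopy_equivalent_space
         geometric_realization (barycentric_subdivision (Lambda_complex n lam m))
       \<and> geometric_realization (order_complex (pointed_filter n lam m - {pointed_top n}) pointed_le)
           homotopy_equivalent_space
         geometric_realization (Lambda_complex n lam m)"
proof -
  let ?K = "Lambda_complex n lam m" and ?P = "pointed_filter n lam m - {pointed_top n}"
  define f where "f s = cut_partition n (hd ` s)" for s
  define a where "a p = cut n ({1..n} - snd p)" for p :: pointed_partition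
  define cuts where "cuts c = (\<lambda>p. {1..n} - snd p) ` c" for c :: "pointed_partition set"
  have a_image: "a ` c = cut n ` cuts c" for c
    by (simp add: a_def cuts_def image_image)
  have face: "\<exists>W. s = cut n ` W \<and> hd ` s = W \<and> finite W \<and> W \<subseteq> Pow {1..n} - {{}} \<and>
      Complete_Partial_Order.chain (\<subseteq>) W \<and> cut_partition n W \<in> pointed_filter n lam m"
    if s: "s \<in> ?K" for s
  proof -
    obtain W where W: "s = cut n ` W" "W \<subseteq> Pow {1..n} - {{}}"
        "Complete_Partial_Order.chain (\<subseteq>) W" "cut_partition n W \<in> pointed_filter n lam m"
      using s unfolding Lambda_complex_eq by blast
    moreover have "finite W"
      using W(2) by (rule finite_subset) simp
    moreover have "hd ` s = W"
      unfolding W(1) by (rule hd_cut_image)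
    ultimately show ?thesis
      by (intro exI[of _ W] conjI)
  qed
  have P: "?P \<subseteq> pointed_partitions n"
    by (auto simp: pointed_filter_def)
  have cuts_le: "pointed_le p (cut_partition n (cuts c))"
    if "c \<in> order_complex ?P pointed_le" "p \<in> c" "\<forall>q\<in>c. pointed_le p q" for c p
  proof -
    have "c \<subseteq> pointed_partitions n"
      using that(1) P by (auto simp: order_complex_def)
    then show ?thesis
      unfolding cuts_def using that by (intro pointed_le_cut_partition) auto
  qed
  have "geometric_realization (barycentric_subdivision ?K) homotopy_equivalent_space
      geometric_realization (order_complex ?P pointed_le)"
  proof (rule sd_homotopy_equivalent_order_complex[where f = f and a = a])
    show "finite ?P"
      using P finite_pointed_partitions by (rule finite_subset)
  next
    fix s assume s: "s \<in> ?K - {{}}"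
    then obtain W where W: "s = cut n ` W" "hd ` s = W" "finite W" "W \<subseteq> Pow {1..n} - {{}}"
        "Complete_Partial_Order.chain (\<subseteq>) W" "cut_partition n W \<in> pointed_filter n lam m"
      using face[of s] by blast
    have "W \<noteq> {}"
      using s W(1) by auto
    then have Max: "\<Union>W \<in> W"
      using W(3,5) by (intro chain_subset_Max)
    then have "\<Union>W \<in> Pow {1..n} - {{}}"
      using W(4) by (rule rev_subsetD)
    \<comment> \<open>The inequality separates \<open>f s\<close> from the top; the equation makes
      \<open>a (f s)\<close> the cut at the largest set of the chain, which is a vertex of
      \<open>s\<close>.\<close>
    then have "{1..n} - \<Union>W \<noteq> {1..n}" "{1..n} - ({1..n} - \<Union>W) = \<Union>W"
      by auto
    then show "f s \<in> ?P" "a (f s) \<in> s"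
      using W(6) Max by (auto simp: f_def a_def W(2) W(1) cut_partition_def pointed_top_def hd_cut_image)
  next
    fix s t assume "t \<in> ?K - {{}}" "s \<subseteq> t"
    then show "pointed_le (f t) (f s)"
      using face[of t] unfolding f_def by (intro cut_partition_antimono image_mono) auto
  next
    fix c assume c: "c \<in> order_complex ?P pointed_le" "c \<noteq> {}"
    then have chain: "finite c" "Complete_Partial_Order.chain pointed_le c" "c \<subseteq> ?P"
      by (auto simp: order_complex_def)
    obtain p where p: "p \<in> c" "\<forall>q\<in>c. pointed_le p q"
      using chain_least[OF chain(1) c(2) chain(2) reflp_pointed_le transp_pointed_le] by blast
    \<comment> \<open>Only the top has all of \<open>{1..n}\<close> as pointed block, since no
      nonempty block then fits beside it.\<close>
    have snd_ne: "{1..n} - snd q \<noteq> {}" if "q \<in> c" for q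
    proof
      assume *: "{1..n} - snd q = {}"
      have "q \<in> pointed_partitions n" "q \<noteq> pointed_top n"
        using that chain(3) P by auto
      then show False
        using * by (cases q) (auto simp: pointed_partitions_def pointed_top_def partition_on_def)
    qed
    then have sub: "cuts c \<subseteq> Pow {1..n} - {{}}"
      by (auto simp: cuts_def)
    have "Complete_Partial_Order.chain (\<subseteq>) (cuts c)"
    proof (rule chainI)
      fix A B assume "A \<in> cuts c" "B \<in> cuts c"
      then obtain q r where qr: "q \<in> c" "r \<in> c" "A = {1..n} - snd q" "B = {1..n} - snd r"
        by (auto simp: cuts_def)
      then have "snd q \<subseteq> snd r \<or> snd r \<subseteq> snd q"
        using chainD[OF chain(2), of q r] by (cases q; cases r) (auto simp: pointed_le_iff)
      then show "A \<subseteq> B \<or> B \<subseteq> A"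
        using qr by auto
    qed
    moreover have "cut_partition n (cuts c) \<in> pointed_filter n lam m"
    proof (rule pointed_filter_upward)
      show "p \<in> pointed_filter n lam m"
        using p(1) chain(3) by auto
      show "pointed_le p (cut_partition n (cuts c))"
        using c(1) p by (rule cuts_le)
      show "cut_partition n (cuts c) \<in> pointed_partitions n"
        using sub by (intro cut_partition_mem) auto
    qed
    ultimately show "a ` c \<in> ?K"
      unfolding Lambda_complex_eq a_image using sub by blast
  next
    fix c p assume "c \<in> order_complex ?P pointed_le" "p \<in> c" "\<forall>q\<in>c. pointed_le p q"
    then show "pointed_le p (f (a ` c))"
      unfolding f_def a_image hd_cut_image by (rule cuts_le)
  qed (fact finite_complex_Lambda reflp_pointed_le transp_pointed_le)+
  then have "geometric_realization (order_complex ?P pointed_le) homotopy_equivalent_space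
      geometric_realization (barycentric_subdivision ?K)"
    by (rule homotopy_equivalent_space_sym[THEN iffD1])
  then show ?thesis
    by (intro conjI homotopy_eqv_trans[OF _ sd_homotopy_equivalent[OF finite_complex_Lambda]])
qed

end
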